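(* Let $\mathcal{H}_1,\mathcal{H}_2$ be separable Hilbert spaces with $\mathcal{H}_1$ compactly embedded into $\mathcal{H}_2$, and let $V$ be any dense set in $\mathcal{H}_2$. For some fixed $T>0$ let $\Psi^n:\Omega\to C([0,T];\mathcal{H}_1)$, $n\in\mathbb{N}$, be a sequence of measurable processes such that $$\sup_{n\in\mathbb{N}}\mathbb{E}\Big(\sup_{t\in[0,T]}\|\Psi^n_t\|_{\mathcal{H}_1}\Big)<\infty$$ and for any sequence of stopping times $(\gamma_n)$ with $\gamma_n:\Omega\to[0,T]$, and any $\varepsilon>0$, $v\in V$, $$\lim_{\delta\to0^+}\sup_{n\in\mathbb{N}}\mathbb{P}\Big(\Big\{\omega\in\Omega:\big|\langle\Psi^n_{(\gamma_n+\delta)\wedge T}-\Psi^n_{\gamma_n},v\rangle_{\mathcal{H}_2}\big|>\varepsilon\Big\}\Big)=0.$$ Then the sequence of the laws of $(\Psi^n)$ is tight in the space of probability measures over $\mathcal{D}([0,T];\mathcal{H}_2)$.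
   Context: $(\Omega,\mathcal{F},(\mathcal{F}_t)_{t\ge0},\mathbb{P})$ is a fixed filtered probability space, complete with respect to $\mathcal{F}_0$; stopping times are with respect to $(\mathcal{F}_t)$. Banach spaces carry their Borel $\sigma$-algebras. $C([0,T];\mathcal{H}_1)$ is the space of continuous functions from $[0,T]$ into $\mathcal{H}_1$. $\mathcal{D}([0,T];\mathcal{H}_2)$ is the space of càdlàg functions $[0,T]\to\mathcal{H}_2$ with the Skorohod topology, induced by the metric $d(\phi,\psi)=\inf_\eta\big[\sup_{t\in[0,T]}|\eta(t)-t|\vee\sup_{t\in[0,T]}\|\phi(t)-\psi(\eta(t))\|_{\mathcal{H}_2}\big]$, the infimum being over strictly increasing continuous maps $\eta$ of $[0,T]$ onto itself.
   Formalization: The processes Ψⁿ are additionally assumed adapted to the filtration (F_t); without this the claim fails, e.g. for spikes max(0, 1 − n|t − U|) at a uniform time U with the trivial completed filtration. *)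

theory Defs
  imports "HOL-Probability.Probability"
begin

section \<open>Filtered probability spaces\<close>

text \<open>Only the \<sigma>-algebras \<open>F t\<close> with \<open>0 \<le> t\<close> are meaningful. Completeness with respect to \<open>F 0\<close>:
  every subset of a null set belongs to \<open>F 0\<close>, hence to \<open>M\<close> and to all \<open>F t\<close>.\<close>

locale filtered_prob_space = prob_space M
  for M :: "'w measure" +
  fixes F :: "real \<Rightarrow> 'w measure"
  assumes subalgebra_F: "0 \<le> t \<Longrightarrow> subalgebra M (F t)"
    and F_mono: "0 \<le> s \<Longrightarrow> s \<le> t \<Longrightarrow> sets (F s) \<subseteq> sets (F t)"
    and F_complete: "N \<in> null_sets M \<Longrightarrow> A \<subseteq> N \<Longrightarrow> A \<in> sets (F 0)"

text \<open>The library's \<^const>\<open>stopping_time\<close> quantifies over the whole index type; freezing the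
  filtration at time 0 for negative times discards the meaningless \<open>F t\<close>, \<open>t < 0\<close>.\<close>

definition nonneg_stopping_time :: "(real \<Rightarrow> 'w measure) \<Rightarrow> ('w \<Rightarrow> real) \<Rightarrow> bool" where
  "nonneg_stopping_time F \<tau> \<longleftrightarrow> stopping_time (\<lambda>t. F (max 0 t)) \<tau>"


section \<open>Compact embeddings, Borel sets and tightness\<close>

definition compact_embedding :: "('a::real_normed_vector \<Rightarrow> 'b::real_normed_vector) \<Rightarrow> bool" where
  "compact_embedding \<iota> \<longleftrightarrow>
     bounded_linear \<iota> \<and> inj \<iota> \<and> (\<forall>B. bounded B \<longrightarrow> compact (closure (\<iota> ` B)))"

definition borel_of :: "'a topology \<Rightarrow> 'a measure" where
  "borel_of X = sigma (topspace X) {U. openin X U}"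

definition tight_in :: "'a topology \<Rightarrow> ('i \<Rightarrow> 'a measure) \<Rightarrow> bool" where
  "tight_in X \<mu> \<longleftrightarrow>
     (\<forall>i. prob_space (\<mu> i) \<and> sets (\<mu> i) = sets (borel_of X)) \<and>
     (\<forall>\<epsilon>>0. \<exists>K. compactin X K \<and> K \<in> sets (borel_of X) \<and> (\<forall>i. measure (\<mu> i) K \<ge> 1 - \<epsilon>))"


section \<open>Path spaces\<close>

text \<open>Paths on \<open>[0,T]\<close> are functions on \<open>real\<close> that are \<^const>\<open>undefined\<close> off \<open>{0..T}\<close>, so that
  equality of paths is equality on \<open>[0,T]\<close>. Here \<^const>\<open>cfunspace\<close> carries the supremum metric.\<close>

abbreviation C_metric :: "real \<Rightarrow> (real \<Rightarrow> 'a::real_normed_vector) metric" where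
  "C_metric T \<equiv> cfunspace (top_of_set {0..T}) euclidean_metric"

definition cadlag_paths :: "real \<Rightarrow> (real \<Rightarrow> 'a::metric_space) set" where
  "cadlag_paths T = {\<phi> \<in> extensional {0..T}.
     (\<forall>t\<in>{0..<T}. (\<phi> \<longlongrightarrow> \<phi> t) (at_right t)) \<and>
     (\<forall>t\<in>{0<..T}. \<exists>l. (\<phi> \<longlongrightarrow> l) (at_left t))}"

definition time_changes :: "real \<Rightarrow> (real \<Rightarrow> real) set" where
  "time_changes T =
     {\<eta>. strict_mono_on {0..T} \<eta> \<and> continuous_on {0..T} \<eta> \<and> \<eta> ` {0..T} = {0..T}}"

text \<open>The value 0 off \<open>cadlag_paths T\<close> is the totality convention of \<^locale>\<open>Metric_space\<close>, which
  asks for symmetry and nonnegativity on the whole type.\<close>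

definition skorohod_dist ::
  "real \<Rightarrow> (real \<Rightarrow> 'a::metric_space) \<Rightarrow> (real \<Rightarrow> 'a) \<Rightarrow> real" where
  "skorohod_dist T \<phi> \<psi> =
     (if \<phi> \<in> cadlag_paths T \<and> \<psi> \<in> cadlag_paths T
      then INF \<eta>\<in>time_changes T.
             max (SUP t\<in>{0..T}. \<bar>\<eta> t - t\<bar>) (SUP t\<in>{0..T}. dist (\<phi> t) (\<psi> (\<eta> t)))
      else 0)"

definition skorohod_metric :: "real \<Rightarrow> (real \<Rightarrow> 'a::metric_space) metric" where
  "skorohod_metric T = metric (cadlag_paths T, skorohod_dist T)"

subsection \<open>The Skorohod distance is a metric\<close>

text \<open>This is what gives \<^const>\<open>skorohod_metric\<close> its meaning, as \<^typ>\<open>'a metric\<close> is a subtype.\<close>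

lemma cadlag_paths_bounded:
  assumes "\<phi> \<in> cadlag_paths T"
  shows "bounded (\<phi> ` {0..T})"
proof -
  have loc: "\<exists>U. open U \<and> t \<in> U \<and> bounded (\<phi> ` (U \<inter> {0..T}))" if t: "t \<in> {0..T}" for t
  proof -
    have "\<exists>b>t. bounded (\<phi> ` ({t<..<b} \<inter> {0..T}))"
    proof (cases "t < T")
      case True
      then have "(\<phi> \<longlongrightarrow> \<phi> t) (at_right t)"
        using assms t by (auto simp: cadlag_paths_def)
      then have "eventually (\<lambda>s. dist (\<phi> s) (\<phi> t) < 1) (at_right t)"
        by (rule tendstoD) simp
      then obtain b where b: "b > t" "\<And>s. t < s \<Longrightarrow> s < b \<Longrightarrow> dist (\<phi> s) (\<phi> t) < 1"
        by (auto simp: eventually_at_right[OF True])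
      then have "\<phi> ` ({t<..<b} \<inter> {0..T}) \<subseteq> ball (\<phi> t) 1"
        by (auto simp: dist_commute)
      with b(1) show ?thesis
        using bounded_subset[OF bounded_ball] by blast
    next
      case False
      then have "{t<..<t + 1} \<inter> {0..T} = {}" by auto
      then show ?thesis by (intro exI[of _ "t + 1"]) simp
    qed
    then obtain b where b: "b > t" "bounded (\<phi> ` ({t<..<b} \<inter> {0..T}))" by blast
    have "\<exists>a<t. bounded (\<phi> ` ({a<..<t} \<inter> {0..T}))"
    proof (cases "0 < t")
      case True
      then have "\<exists>l. (\<phi> \<longlongrightarrow> l) (at_left t)"
        using assms t by (auto simp: cadlag_paths_def)
      then obtain l where "(\<phi> \<longlongrightarrow> l) (at_left t)" by blast
      then have "eventually (\<lambda>s. dist (\<phi> s) l < 1) (at_left t)"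
        by (rule tendstoD) simp
      then obtain a where a: "a < t" "\<And>s. a < s \<Longrightarrow> s < t \<Longrightarrow> dist (\<phi> s) l < 1"
        by (auto simp: eventually_at_left[OF True])
      then have "\<phi> ` ({a<..<t} \<inter> {0..T}) \<subseteq> ball l 1"
        by (auto simp: dist_commute)
      with a(1) show ?thesis
        using bounded_subset[OF bounded_ball] by blast
    next
      case False
      then have "{t - 1<..<t} \<inter> {0..T} = {}" by auto
      then show ?thesis by (intro exI[of _ "t - 1"]) simp
    qed
    then obtain a where a: "a < t" "bounded (\<phi> ` ({a<..<t} \<inter> {0..T}))" by blast
    have "\<phi> ` ({a<..<b} \<inter> {0..T}) \<subseteq>
        \<phi> ` ({a<..<t} \<inter> {0..T}) \<union> {\<phi> t} \<union> \<phi> ` ({t<..<b} \<inter> {0..T})"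
      by (auto simp: image_iff) (metis IntI atLeastAtMost_iff greaterThanLessThan_iff linorder_neqE_linordered_idom)+
    moreover have "bounded (\<phi> ` ({a<..<t} \<inter> {0..T}) \<union> {\<phi> t} \<union> \<phi> ` ({t<..<b} \<inter> {0..T}))"
      using a(2) b(2) by simp
    ultimately have "bounded (\<phi> ` ({a<..<b} \<inter> {0..T}))"
      by (rule bounded_subset[rotated])
    with a(1) b(1) show ?thesis
      by (intro exI[of _ "{a<..<b}"]) auto
  qed
  then obtain U where U: "\<And>t. t \<in> {0..T} \<Longrightarrow> open (U t) \<and> t \<in> U t \<and> bounded (\<phi> ` (U t \<inter> {0..T}))"
    by metis
  obtain S where S: "S \<subseteq> {0..T}" "finite S" "{0..T} \<subseteq> (\<Union>t\<in>S. U t)"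
    by (rule compactE_image[of "{0..T}" "{0..T}" U]) (use U in auto)
  have "bounded (\<Union>t\<in>S. \<phi> ` (U t \<inter> {0..T}))"
    using S U by (intro bounded_UN) auto
  then show ?thesis
    by (rule bounded_subset) (use S in blast)
qed

lemma time_changes_mem: "\<eta> \<in> time_changes T \<Longrightarrow> t \<in> {0..T} \<Longrightarrow> \<eta> t \<in> {0..T}"
  by (simp only: time_changes_def mem_Collect_eq) (metis imageI)

lemma id_in_time_changes: "(\<lambda>t. t) \<in> time_changes T"
  by (auto simp: time_changes_def strict_mono_on_def)

lemma time_changes_comp:
  assumes "\<eta> \<in> time_changes T" "\<theta> \<in> time_changes T"
  shows "(\<lambda>t. \<theta> (\<eta> t)) \<in> time_changes T"
proof -
  have sm: "strict_mono_on {0..T} \<eta>" "strict_mono_on {0..T} \<theta>"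
    and c: "continuous_on {0..T} \<eta>" "continuous_on {0..T} \<theta>"
    and im: "\<eta> ` {0..T} = {0..T}" "\<theta> ` {0..T} = {0..T}"
    using assms unfolding time_changes_def mem_Collect_eq by blast+
  have "(\<lambda>t. \<theta> (\<eta> t)) ` {0..T} = \<theta> ` \<eta> ` {0..T}"
    by (simp only: image_image)
  then have "(\<lambda>t. \<theta> (\<eta> t)) ` {0..T} = {0..T}"
    by (simp only: im)
  moreover have "continuous_on {0..T} (\<lambda>t. \<theta> (\<eta> t))"
    by (rule continuous_on_compose2[OF c(2) c(1)]) (simp only: im order_refl)
  moreover have "strict_mono_on {0..T} (\<lambda>t. \<theta> (\<eta> t))"
  proof (rule strict_mono_onI)
    fix s t assume "s \<in> {0..T}" "t \<in> {0..T}" "s < t"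
    then show "\<theta> (\<eta> s) < \<theta> (\<eta> t)"
      by (intro strict_mono_onD[OF sm(2)] strict_mono_onD[OF sm(1)] time_changes_mem[OF assms(1)])
  qed
  ultimately show ?thesis
    unfolding time_changes_def mem_Collect_eq by blast
qed

lemma time_changes_inverse:
  assumes "\<eta> \<in> time_changes T"
  obtains \<theta> where "\<theta> \<in> time_changes T" "\<And>t. t \<in> {0..T} \<Longrightarrow> \<eta> (\<theta> t) = t"
proof -
  have inj: "inj_on \<eta> {0..T}" and im: "\<eta> ` {0..T} = {0..T}"
    and c: "continuous_on {0..T} \<eta>" and sm: "strict_mono_on {0..T} \<eta>"
    using assms by (auto simp: time_changes_def intro: strict_mono_on_imp_inj_on)
  define \<theta> where "\<theta> = the_inv_into {0..T} \<eta>"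
  have l: "\<theta> (\<eta> t) = t" if "t \<in> {0..T}" for t
    unfolding \<theta>_def using inj that by (rule the_inv_into_f_f)
  have r: "\<eta> (\<theta> t) = t" if "t \<in> {0..T}" for t
    unfolding \<theta>_def using inj that im by (metis f_the_inv_into_f)
  have im': "\<theta> ` {0..T} = {0..T}"
    using l im by (metis (no_types, lifting) image_cong image_ident image_image)
  have "continuous_on {0..T} \<theta>"
    using continuous_on_inv[OF c, of \<theta>] l im by simp
  moreover have "strict_mono_on {0..T} \<theta>"
    unfolding strict_mono_on_def
  proof (intro allI impI, elim conjE)
    fix s t assume st: "s \<in> {0..T}" "t \<in> {0..T}" "s < t"
    then have mem: "\<theta> s \<in> {0..T}" "\<theta> t \<in> {0..T}" using im' by blast+
    show "\<theta> s < \<theta> t"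
    proof (rule ccontr)
      assume "\<not> \<theta> s < \<theta> t"
      then have "\<eta> (\<theta> t) \<le> \<eta> (\<theta> s)"
        using sm mem by (auto intro: strict_mono_on_leD)
      with st r show False by simp
    qed
  qed
  ultimately have "\<theta> \<in> time_changes T"
    using im' by (simp add: time_changes_def)
  with r show ?thesis using that by blast
qed

lemma skorohod_dist_less_iff:
  assumes T: "0 \<le> T" and \<phi>: "\<phi> \<in> cadlag_paths T" and \<psi>: "\<psi> \<in> cadlag_paths T"
  shows "skorohod_dist T \<phi> \<psi> < r \<longleftrightarrow>
    (\<exists>e<r. \<exists>\<eta>\<in>time_changes T. \<forall>t\<in>{0..T}. \<bar>\<eta> t - t\<bar> \<le> e \<and> dist (\<phi> t) (\<psi> (\<eta> t)) \<le> e)"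
proof -
  define A where "A \<eta> = (SUP t\<in>{0..T}. \<bar>\<eta> t - t\<bar>)" for \<eta> :: "real \<Rightarrow> real"
  define B where "B \<eta> = (SUP t\<in>{0..T}. dist (\<phi> t) (\<psi> (\<eta> t)))" for \<eta>
  obtain c where c: "\<And>x y. x \<in> \<phi> ` {0..T} \<union> \<psi> ` {0..T} \<Longrightarrow> y \<in> \<phi> ` {0..T} \<union> \<psi> ` {0..T} \<Longrightarrow> dist x y \<le> c"
    using bounded_Un[of "\<phi> ` {0..T}" "\<psi> ` {0..T}"] cadlag_paths_bounded[OF \<phi>]
      cadlag_paths_bounded[OF \<psi>] by (metis bounded_two_points)
  have le: "max (A \<eta>) (B \<eta>) \<le> e \<longleftrightarrow> (\<forall>t\<in>{0..T}. \<bar>\<eta> t - t\<bar> \<le> e \<and> dist (\<phi> t) (\<psi> (\<eta> t)) \<le> e)"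
    if \<eta>: "\<eta> \<in> time_changes T" for \<eta> e
  proof -
    have bA: "bdd_above ((\<lambda>t. \<bar>\<eta> t - t\<bar>) ` {0..T})"
    proof (rule bdd_aboveI2)
      fix t assume "t \<in> {0..T}"
      then show "\<bar>\<eta> t - t\<bar> \<le> T" using time_changes_mem[OF \<eta>, of t] by auto
    qed
    have bB: "bdd_above ((\<lambda>t. dist (\<phi> t) (\<psi> (\<eta> t))) ` {0..T})"
      by (rule bdd_aboveI2[of _ _ c]) (use c time_changes_mem[OF \<eta>] in blast)
    have ne: "{0..T} \<noteq> {}" using T by simp
    have "A \<eta> \<le> e \<longleftrightarrow> (\<forall>t\<in>{0..T}. \<bar>\<eta> t - t\<bar> \<le> e)"
      "B \<eta> \<le> e \<longleftrightarrow> (\<forall>t\<in>{0..T}. dist (\<phi> t) (\<psi> (\<eta> t)) \<le> e)"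
      unfolding A_def B_def by (rule cSUP_le_iff[OF ne bA] cSUP_le_iff[OF ne bB])+
    then show ?thesis by (simp add: ball_conj_distrib)
  qed
  have nn: "0 \<le> max (A \<eta>) (B \<eta>)" if "\<eta> \<in> time_changes T" for \<eta>
  proof -
    have "\<bar>\<eta> 0 - 0\<bar> \<le> max (A \<eta>) (B \<eta>)"
      using le[OF that, of "max (A \<eta>) (B \<eta>)"] T by (metis atLeastAtMost_iff order_refl)
    then show ?thesis by linarith
  qed
  have "skorohod_dist T \<phi> \<psi> = (INF \<eta>\<in>time_changes T. max (A \<eta>) (B \<eta>))"
    using \<phi> \<psi> by (simp add: skorohod_dist_def A_def B_def)
  also have "\<dots> < r \<longleftrightarrow> (\<exists>\<eta>\<in>time_changes T. max (A \<eta>) (B \<eta>) < r)"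
    by (rule cINF_less_iff) (use id_in_time_changes nn in \<open>auto intro: bdd_belowI2[of _ 0]\<close>)
  also have "\<dots> \<longleftrightarrow> (\<exists>e<r. \<exists>\<eta>\<in>time_changes T. max (A \<eta>) (B \<eta>) \<le> e)"
    by (meson order_refl le_less_trans)
  finally show ?thesis by (simp only: le cong: bex_cong)
qed

lemma Metric_space_skorohod:
  assumes T: "0 \<le> T"
  shows "Metric_space (cadlag_paths T :: (real \<Rightarrow> 'a::metric_space) set) (skorohod_dist T)"
proof
  note less = skorohod_dist_less_iff[OF T]
  show nonneg: "0 \<le> skorohod_dist T \<phi> \<psi>" for \<phi> \<psi> :: "real \<Rightarrow> 'a"
  proof (rule ccontr)
    assume *: "\<not> 0 \<le> skorohod_dist T \<phi> \<psi>"
    then have "\<phi> \<in> cadlag_paths T" "\<psi> \<in> cadlag_paths T"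
      by (auto simp: skorohod_dist_def split: if_splits)
    with * T show False
      using less[of \<phi> \<psi> 0] by (smt (verit) atLeastAtMost_iff zero_le_dist)
  qed
  have sym: "skorohod_dist T \<psi> \<phi> \<le> skorohod_dist T \<phi> \<psi>"
    if m: "\<phi> \<in> cadlag_paths T" "\<psi> \<in> cadlag_paths T" for \<phi> \<psi> :: "real \<Rightarrow> 'a"
  proof (rule field_le_epsilon)
    fix h :: real assume "0 < h"
    then have "skorohod_dist T \<phi> \<psi> < skorohod_dist T \<phi> \<psi> + h" by simp
    then obtain e \<eta> where e: "e < skorohod_dist T \<phi> \<psi> + h" and \<eta>: "\<eta> \<in> time_changes T"
      and b: "\<And>t. t \<in> {0..T} \<Longrightarrow> \<bar>\<eta> t - t\<bar> \<le> e \<and> dist (\<phi> t) (\<psi> (\<eta> t)) \<le> e"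
      using less[OF m] by blast
    obtain \<theta> where \<theta>: "\<theta> \<in> time_changes T" "\<And>t. t \<in> {0..T} \<Longrightarrow> \<eta> (\<theta> t) = t"
      using time_changes_inverse[OF \<eta>] by blast
    have "\<bar>\<theta> t - t\<bar> \<le> e \<and> dist (\<psi> t) (\<phi> (\<theta> t)) \<le> e" if "t \<in> {0..T}" for t
      using b[OF time_changes_mem[OF \<theta>(1) that]] \<theta>(2)[OF that]
      by (simp add: abs_minus_commute dist_commute)
    then have "skorohod_dist T \<psi> \<phi> < skorohod_dist T \<phi> \<psi> + h"
      using less[OF m(2) m(1)] e \<theta>(1) by blast
    then show "skorohod_dist T \<psi> \<phi> \<le> skorohod_dist T \<phi> \<psi> + h" by simp
  qed
  show "skorohod_dist T \<phi> \<psi> = skorohod_dist T \<psi> \<phi>" for \<phi> \<psi> :: "real \<Rightarrow> 'a"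
  proof (cases "\<phi> \<in> cadlag_paths T \<and> \<psi> \<in> cadlag_paths T")
    case True
    then show ?thesis using sym by (simp add: order_antisym)
  qed (auto simp: skorohod_dist_def)
  show "skorohod_dist T \<phi> \<rho> \<le> skorohod_dist T \<phi> \<psi> + skorohod_dist T \<psi> \<rho>"
    if m: "\<phi> \<in> cadlag_paths T" "\<psi> \<in> cadlag_paths T" "\<rho> \<in> cadlag_paths T" for \<phi> \<psi> \<rho> :: "real \<Rightarrow> 'a"
  proof (rule field_le_epsilon)
    fix h :: real assume "0 < h"
    then have "skorohod_dist T \<phi> \<psi> < skorohod_dist T \<phi> \<psi> + h / 2"
      "skorohod_dist T \<psi> \<rho> < skorohod_dist T \<psi> \<rho> + h / 2" by auto
    then obtain e \<eta> e' \<theta> where e: "e < skorohod_dist T \<phi> \<psi> + h / 2" and \<eta>: "\<eta> \<in> time_changes T"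
      and b: "\<forall>t\<in>{0..T}. \<bar>\<eta> t - t\<bar> \<le> e \<and> dist (\<phi> t) (\<psi> (\<eta> t)) \<le> e"
      and e': "e' < skorohod_dist T \<psi> \<rho> + h / 2" and \<theta>: "\<theta> \<in> time_changes T"
      and b': "\<forall>t\<in>{0..T}. \<bar>\<theta> t - t\<bar> \<le> e' \<and> dist (\<psi> t) (\<rho> (\<theta> t)) \<le> e'"
      unfolding less[OF m(1,2)] less[OF m(2,3)] by (elim exE conjE bexE)
    have "\<bar>\<theta> (\<eta> t) - t\<bar> \<le> e + e' \<and> dist (\<phi> t) (\<rho> (\<theta> (\<eta> t))) \<le> e + e'" if "t \<in> {0..T}" for t
    proof
      show "\<bar>\<theta> (\<eta> t) - t\<bar> \<le> e + e'"
        using bspec[OF b that] bspec[OF b' time_changes_mem[OF \<eta> that]] by linarith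
      show "dist (\<phi> t) (\<rho> (\<theta> (\<eta> t))) \<le> e + e'"
        using bspec[OF b that] bspec[OF b' time_changes_mem[OF \<eta> that]]
          dist_triangle[of "\<phi> t" "\<rho> (\<theta> (\<eta> t))" "\<psi> (\<eta> t)"] by linarith
    qed
    moreover have "e + e' < skorohod_dist T \<phi> \<psi> + skorohod_dist T \<psi> \<rho> + h"
      using e e' by linarith
    ultimately have "skorohod_dist T \<phi> \<rho> < skorohod_dist T \<phi> \<psi> + skorohod_dist T \<psi> \<rho> + h"
      using time_changes_comp[OF \<eta> \<theta>]
      by (intro iffD2[OF less[OF m(1,3)]] exI[of _ "e + e'"] conjI bexI[of _ "\<lambda>t. \<theta> (\<eta> t)"]) auto
    then show "skorohod_dist T \<phi> \<rho> \<le> skorohod_dist T \<phi> \<psi> + skorohod_dist T \<psi> \<rho> + h" by simp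
  qed
  show "skorohod_dist T \<phi> \<psi> = 0 \<longleftrightarrow> \<phi> = \<psi>"
    if m: "\<phi> \<in> cadlag_paths T" "\<psi> \<in> cadlag_paths T" for \<phi> \<psi> :: "real \<Rightarrow> 'a"
  proof
    assume "\<phi> = \<psi>"
    then have "skorohod_dist T \<phi> \<psi> < r" if "0 < r" for r
      using less[OF m, of r] that id_in_time_changes[of T]
      by (auto intro!: exI[of _ 0] bexI[of _ "\<lambda>t. t"])
    with nonneg show "skorohod_dist T \<phi> \<psi> = 0" by (metis antisym_conv2 order_less_irrefl)
  next
    assume 0: "skorohod_dist T \<phi> \<psi> = 0"
    have near: "\<exists>s\<in>{0..T}. \<bar>s - t\<bar> < r \<and> dist (\<phi> t) (\<psi> s) < r \<and> (t = T \<longrightarrow> s = T)"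
      if r: "0 < r" and t: "t \<in> {0..T}" for r t
    proof -
      obtain e \<eta> where e: "e < r" and \<eta>: "\<eta> \<in> time_changes T"
        and b: "\<And>t. t \<in> {0..T} \<Longrightarrow> \<bar>\<eta> t - t\<bar> \<le> e \<and> dist (\<phi> t) (\<psi> (\<eta> t)) \<le> e"
        using less[OF m, of r] 0 r by auto
      have "\<eta> T = T"
      proof -
        obtain u where u: "u \<in> {0..T}" "\<eta> u = T"
          using \<eta> T unfolding time_changes_def by (metis (mono_tags, lifting) CollectD atLeastAtMost_iff imageE order_refl)
        then have "\<eta> u \<le> \<eta> T"
          using \<eta> T by (auto simp: time_changes_def intro: strict_mono_on_leD)
        then show ?thesis using u time_changes_mem[OF \<eta>, of T] T by auto
      qed
      then show ?thesis
        using b[OF t] e time_changes_mem[OF \<eta> t] by (intro bexI[of _ "\<eta> t"]) auto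
    qed
    have "\<phi> t = \<psi> t" if t: "t \<in> {0..T}" for t
    proof (cases "t = T")
      case True
      have "dist (\<phi> t) (\<psi> t) < r" if "0 < r" for r
        using near[OF that t] True by auto
      then show ?thesis by (metis dist_nz order_less_irrefl)
    next
      case False
      with t have tT: "t < T" by auto
      have R: "(\<phi> \<longlongrightarrow> \<phi> t) (at_right t)" "(\<psi> \<longlongrightarrow> \<psi> t) (at_right t)"
        using m t tT by (auto simp: cadlag_paths_def)
      have "dist (\<phi> t) (\<psi> t) < r" if r: "0 < r" for r
      proof -
        have "eventually (\<lambda>s. dist (\<phi> s) (\<phi> t) < r / 3) (at_right t)"
          "eventually (\<lambda>s. dist (\<psi> s) (\<psi> t) < r / 3) (at_right t)"
          using R[THEN tendstoD, of "r / 3"] r by auto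
        then have "eventually (\<lambda>s. dist (\<phi> s) (\<phi> t) < r / 3 \<and> dist (\<psi> s) (\<psi> t) < r / 3) (at_right t)"
          by (rule eventually_conj)
        then obtain b where b: "b > t"
          "\<And>s. t < s \<Longrightarrow> s < b \<Longrightarrow> dist (\<phi> s) (\<phi> t) < r / 3 \<and> dist (\<psi> s) (\<psi> t) < r / 3"
          by (auto simp: eventually_at_right[OF tT])
        define u where "u = (t + min b T) / 2"
        have u: "t < u" "u < b" "u \<in> {0..T}" using b(1) tT t by (auto simp: u_def)
        obtain s where s: "\<bar>s - u\<bar> < min (r / 3) (min (u - t) (b - u))"
          "dist (\<phi> u) (\<psi> s) < min (r / 3) (min (u - t) (b - u))"
          using near[of "min (r / 3) (min (u - t) (b - u))" u] u r by auto
        then have "t < s" "s < b" by linarith+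
        then have "dist (\<psi> s) (\<psi> t) < r / 3" "dist (\<phi> u) (\<phi> t) < r / 3" "dist (\<phi> u) (\<psi> s) < r / 3"
          using b(2) u s(2) by auto
        then show ?thesis
          using dist_triangle[of "\<phi> t" "\<psi> t" "\<phi> u"] dist_triangle[of "\<phi> u" "\<psi> t" "\<psi> s"]
          by (simp add: dist_commute)
      qed
      then show ?thesis by (metis dist_nz order_less_irrefl)
    qed
    with m show "\<phi> = \<psi>"
      by (auto simp: cadlag_paths_def intro: extensionalityI)
  qed
qed

lemma mspace_skorohod_metric: "0 \<le> T \<Longrightarrow> mspace (skorohod_metric T) = cadlag_paths T"
  by (simp add: skorohod_metric_def Metric_space.mspace_metric Metric_space_skorohod)

lemma mdist_skorohod_metric: "0 \<le> T \<Longrightarrow> mdist (skorohod_metric T) = skorohod_dist T"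
  by (simp add: skorohod_metric_def Metric_space.mdist_metric Metric_space_skorohod)

end

theory Submission
  imports Defs
begin

text \<open>
  Since the paths are continuous, tightness already holds for the uniform topology, and compact sets
  can be obtained from Arzela--Ascoli. The moment bound confines the paths to a ball of
  \<open>H\<^sub>1\<close> with high probability, hence to a compact set of \<open>H\<^sub>2\<close>,
  on which finitely many functionals \<open>\<langle>\<cdot>, v\<rangle>\<close>, \<open>v \<in> V\<close>, control the norm up to
  \<open>\<epsilon>\<close>. So it suffices to bound the modulus of continuity of each scalar process
  \<open>\<langle>\<Psi>\<^sup>n, v\<rangle>\<close> in probability, uniformly in \<open>n\<close>. This is Aldous' argument: the
  increment condition is uniform over all stopping times; therefore the successive times at which the
  process has moved by a fixed amount are unlikely to be close together, so few of them fit into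
  \<open>[0,T]\<close>, and between them the process hardly moves. The argument is run on a time grid,
  chosen for each \<open>n\<close> so fine that the steps of the process along it are small, which reduces all stopping
  times to discrete ones.
\<close>

section \<open>Successive exit times of a discrete path\<close>

text \<open>The disjunct \<open>N \<le> j\<close> ends the search at the horizon \<open>N\<close> at
  the latest. Hence only a value below \<open>N\<close> certifies a move by more than
  \<open>e\<close>, and \<open>N\<close> is absorbing under iteration.\<close>

definition next_exit :: "nat \<Rightarrow> real \<Rightarrow> (nat \<Rightarrow> 'a::metric_space) \<Rightarrow> nat \<Rightarrow> nat" where
  "next_exit N e z i = (LEAST j. N \<le> j \<or> i < j \<and> e < dist (z j) (z i))"

primrec exit_time :: "nat \<Rightarrow> real \<Rightarrow> (nat \<Rightarrow> 'a::metric_space) \<Rightarrow> nat \<Rightarrow> nat" where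
  "exit_time N e z 0 = 0"
| "exit_time N e z (Suc k) = next_exit N e z (exit_time N e z k)"

lemma next_exit_le: "next_exit N e z i \<le> N"
  unfolding next_exit_def by (rule Least_le) simp

lemma next_exit_exceeds:
  assumes "next_exit N e z i < N"
  shows "i < next_exit N e z i" "e < dist (z (next_exit N e z i)) (z i)"
  using LeastI[of "\<lambda>j. N \<le> j \<or> i < j \<and> e < dist (z j) (z i)" N] assms
  unfolding next_exit_def by auto

lemma next_exit_ge: "i \<le> N \<Longrightarrow> i \<le> next_exit N e z i"
  using next_exit_exceeds(1)[of N e z i] next_exit_le[of N e z i] by linarith

lemma dist_before_next_exit:
  assumes "0 \<le> e" "i \<le> j" "j < next_exit N e z i"
  shows "dist (z j) (z i) \<le> e"
  using not_less_Least[of j "\<lambda>j. N \<le> j \<or> i < j \<and> e < dist (z j) (z i)"] assms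
  unfolding next_exit_def by (cases "i = j") auto

text \<open>For \<open>j < N\<close> the event is decided by \<open>z\<close> at times up to
  \<open>j\<close>; this is what makes exit times stopping times.\<close>

lemma next_exit_eq_iff:
  assumes "j < N"
  shows "next_exit N e z i = j \<longleftrightarrow>
    i < j \<and> e < dist (z j) (z i) \<and> (\<forall>l\<in>{i<..<j}. dist (z l) (z i) \<le> e)"
proof
  assume eq: "next_exit N e z i = j"
  have "dist (z l) (z i) \<le> e" if "l \<in> {i<..<j}" for l
    using not_less_Least[of l "\<lambda>j. N \<le> j \<or> i < j \<and> e < dist (z j) (z i)"] eq that
    unfolding next_exit_def by simp
  with eq assms show "i < j \<and> e < dist (z j) (z i) \<and> (\<forall>l\<in>{i<..<j}. dist (z l) (z i) \<le> e)"
    using next_exit_exceeds[of N e z i] by simp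
next
  assume j: "i < j \<and> e < dist (z j) (z i) \<and> (\<forall>l\<in>{i<..<j}. dist (z l) (z i) \<le> e)"
  show "next_exit N e z i = j"
    unfolding next_exit_def
  proof (rule Least_equality)
    fix l assume l: "N \<le> l \<or> i < l \<and> e < dist (z l) (z i)"
    show "j \<le> l"
    proof (rule ccontr)
      assume "\<not> j \<le> l"
      with l assms have "l \<in> {i<..<j}" "e < dist (z l) (z i)" by auto
      with j show False by (meson not_less)
    qed
  qed (use j in simp)
qed

lemma exit_time_le: "exit_time N e z k \<le> N"
  by (cases k) (auto simp: next_exit_le)

lemma exit_time_mono: "exit_time N e z k \<le> exit_time N e z (Suc k)"
  by (simp add: exit_time_le next_exit_ge)

text \<open>A step of size at most \<open>D\<close> meets at most one exit, since the exits that are real jumps are more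
  than \<open>D\<close> apart; the overshoot at an exit is controlled by the one-step increments.\<close>

lemma dist_le_if_exits_far_apart:
  fixes z :: "nat \<Rightarrow> 'a::metric_space"
  assumes e: "0 \<le> e" and q: "exit_time N e z q = N"
    and far: "\<And>k. k < q \<Longrightarrow> exit_time N e z (Suc k) \<le> exit_time N e z k + D \<Longrightarrow>
      dist (z (exit_time N e z (Suc k))) (z (exit_time N e z k)) \<le> e"
    and step: "\<And>j. j < N \<Longrightarrow> dist (z (Suc j)) (z j) \<le> e"
    and ij: "i \<le> j" "j \<le> N" "j \<le> i + D"
  shows "dist (z i) (z j) \<le> 4 * e"
proof (cases "i = N")
  case True
  with ij e show ?thesis by simp
next
  case False
  define \<tau> where "\<tau> = exit_time N e z"
  have Suc: "\<tau> (Suc k) = next_exit N e z (\<tau> k)" for k by (simp add: \<tau>_def)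
  \<comment> \<open>As \<open>\<tau> q = N\<close> lies beyond \<open>i\<close>, there is a first
    exit beyond \<open>i\<close>; it and its predecessor bracket \<open>i\<close>.\<close>
  have "\<exists>k<q. (\<forall>l\<le>k. \<not> i < \<tau> l) \<and> i < \<tau> (k + 1)"
    using ex_least_nat_less[of "\<lambda>k. i < \<tau> k" q] False ij q unfolding \<tau>_def by simp
  then obtain k where k: "k < q" "\<tau> k \<le> i" "i < \<tau> (Suc k)"
    by (auto simp: not_less)
  have near: "dist (z l) (z (\<tau> k)) \<le> e" if "\<tau> k \<le> l" "l < \<tau> (Suc k)" for l k
    using dist_before_next_exit[OF e, of "\<tau> k" l N z] that Suc by simp
  have i: "dist (z i) (z (\<tau> k)) \<le> e" using near k by simp
  show ?thesis
  proof (cases "j < \<tau> (Suc k)")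
    case True
    then have "dist (z j) (z (\<tau> k)) \<le> e" using near k ij by simp
    with i e show ?thesis using dist_triangle2[of "z i" "z j" "z (\<tau> k)"] by linarith
  next
    case False
    then have j: "\<tau> (Suc k) \<le> j" by simp
    \<comment> \<open>\<open>p\<close> is the last index before the exit, still within
      \<open>e\<close> of the anchor \<open>z (\<tau> k)\<close>. The legs from \<open>i\<close> to
      the anchor, on to \<open>p\<close> and on to the exit cost \<open>e\<close> each.\<close>
    define p where "p = \<tau> (Suc k) - 1"
    have p: "\<tau> (Suc k) = Suc p" "\<tau> k \<le> p" "p < N" using k exit_time_le[of N e z "Suc k"]
      by (auto simp: p_def \<tau>_def)
    have "dist (z p) (z (\<tau> k)) \<le> e" "dist (z (\<tau> (Suc k))) (z p) \<le> e"
      using near[of k p] step[of p] p by auto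
    then have jump: "dist (z i) (z (\<tau> (Suc k))) \<le> 3 * e"
      using i dist_triangle2[of "z i" "z p" "z (\<tau> k)"] dist_triangle3[of "z i" "z (\<tau> (Suc k))" "z p"]
      by (simp add: dist_commute)
    have "dist (z j) (z (\<tau> (Suc k))) \<le> e"
    proof (cases "\<tau> (Suc k) = N")
      case True
      with j ij e show ?thesis by simp
    next
      case N: False
      then have kq: "Suc k < q" using q k by (metis Suc_lessI \<tau>_def)
      show ?thesis
      proof (cases "j < \<tau> (Suc (Suc k))")
        case True
        with near j show ?thesis by simp
      next
        case False
        \<comment> \<open>By \<open>far\<close>, a second exit within \<open>D\<close> is not a real
          jump; so it is the horizon \<open>N\<close>, and \<open>j\<close> sits there.\<close>
        then have "\<tau> (Suc (Suc k)) \<le> \<tau> (Suc k) + D" using ij k by simp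
        then have d: "dist (z (\<tau> (Suc (Suc k)))) (z (\<tau> (Suc k))) \<le> e"
          using far[OF kq] by (simp add: \<tau>_def)
        then have "\<tau> (Suc (Suc k)) = N"
          using next_exit_exceeds(2)[of N e z "\<tau> (Suc k)"] next_exit_le[of N e z "\<tau> (Suc k)"] Suc
          by (metis le_neq_implies_less not_less)
        with False ij have "j = \<tau> (Suc (Suc k))" by simp
        with d show ?thesis by simp
      qed
    qed
    with jump show ?thesis
      using dist_triangle2[of "z i" "z j" "z (\<tau> (Suc k))"] by linarith
  qed
qed

section \<open>Probability estimates for random times\<close>

lemma measurable_pred_countable2:
  fixes f :: "'w \<Rightarrow> 'b::countable" and g :: "'w \<Rightarrow> 'c"
  assumes f: "f \<in> M \<rightarrow>\<^sub>M count_space UNIV" and g: "g \<in> M \<rightarrow>\<^sub>M count_space UNIV"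
  shows "Measurable.pred M (\<lambda>\<omega>. P (f \<omega>) (g \<omega>))"
  by (rule measurable_compose_countable[OF measurable_compose[OF g] f]) simp

context prob_space
begin

text \<open>If \<open>Z\<close> moves by more than \<open>2 a\<close> between \<open>\<sigma>\<close> and \<open>\<rho>\<close>, then at each of the \<open>D\<close> times following
  \<open>\<rho>\<close> it is further than \<open>a\<close> from its value at \<open>\<rho>\<close> or from its value at \<open>\<sigma>\<close>; averaging over these
  times replaces the random lag \<open>\<rho> - \<sigma>\<close> by deterministic ones.\<close>

lemma prob_jump_between_close_times:
  fixes Z :: "nat \<Rightarrow> 'a \<Rightarrow> 'b::{metric_space, second_countable_topology}"
  assumes Z[measurable]: "\<And>k. Z k \<in> borel_measurable M"
    and \<sigma>[measurable]: "\<sigma> \<in> M \<rightarrow>\<^sub>M count_space UNIV" and \<rho>[measurable]: "\<rho> \<in> M \<rightarrow>\<^sub>M count_space UNIV"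
    and D: "0 < D"
    and le_\<sigma>: "\<And>d. 0 < d \<Longrightarrow> d \<le> 2 * D \<Longrightarrow>
      prob {\<omega> \<in> space M. a < dist (Z (\<sigma> \<omega> + d) \<omega>) (Z (\<sigma> \<omega>) \<omega>)} \<le> \<eta>"
    and le_\<rho>: "\<And>d. 0 < d \<Longrightarrow> d \<le> 2 * D \<Longrightarrow>
      prob {\<omega> \<in> space M. a < dist (Z (\<rho> \<omega> + d) \<omega>) (Z (\<rho> \<omega>) \<omega>)} \<le> \<eta>"
  shows "prob {\<omega> \<in> space M. \<sigma> \<omega> \<le> \<rho> \<omega> \<and> \<rho> \<omega> \<le> \<sigma> \<omega> + D \<and>
      2 * a < dist (Z (\<rho> \<omega>) \<omega>) (Z (\<sigma> \<omega>) \<omega>)} \<le> 3 * \<eta>"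
    (is "prob ?E \<le> _")
proof -
  define A where "A d = {\<omega> \<in> space M. a < dist (Z (\<sigma> \<omega> + d) \<omega>) (Z (\<sigma> \<omega>) \<omega>)}" for d
  define B where "B d = {\<omega> \<in> space M. a < dist (Z (\<rho> \<omega> + d) \<omega>) (Z (\<rho> \<omega>) \<omega>)}" for d
  have Zc: "(\<lambda>\<omega>. Z (\<pi> \<omega>) \<omega>) \<in> borel_measurable M"
    if "\<pi> \<in> M \<rightarrow>\<^sub>M count_space UNIV" for \<pi>
    by (rule measurable_compose_countable[OF Z that])
  have [measurable]: "(\<lambda>\<omega>. Z (\<sigma> \<omega>) \<omega>) \<in> borel_measurable M" "(\<lambda>\<omega>. Z (\<rho> \<omega>) \<omega>) \<in> borel_measurable M"
    "(\<lambda>\<omega>. Z (\<sigma> \<omega> + d) \<omega>) \<in> borel_measurable M" "(\<lambda>\<omega>. Z (\<rho> \<omega> + d) \<omega>) \<in> borel_measurable M" for d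
    by (intro Zc; measurable)+
  note [measurable] = measurable_pred_countable2[OF \<sigma> \<rho>, of "\<lambda>i j. i \<le> j"]
    measurable_pred_countable2[OF \<rho> \<sigma>, of "\<lambda>i j. i \<le> j + D"]
  have Am[measurable]: "A d \<in> sets M" and Bm[measurable]: "B d \<in> sets M" for d
    unfolding A_def B_def by measurable
  have E[measurable]: "?E \<in> sets M" by measurable
  have pt: "real D * indicator ?E \<omega> \<le>
      (\<Sum>d\<in>{1..D}. indicator (B d) \<omega>) + (\<Sum>d\<in>{1..2 * D}. indicator (A d) \<omega> :: real)" for \<omega>
  proof (cases "\<omega> \<in> ?E")
    case True
    define l where "l = \<rho> \<omega> - \<sigma> \<omega>"
    have l: "\<rho> \<omega> = \<sigma> \<omega> + l" "l \<le> D" using True by (auto simp: l_def)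
    have "1 \<le> indicator (B d) \<omega> + (indicator (A (l + d)) \<omega> :: real)" for d
    proof (rule ccontr)
      assume "\<not> ?thesis"
      then have "\<omega> \<notin> B d" "\<omega> \<notin> A (l + d)"
        by (auto simp: indicator_def split: if_splits)
      with True l show False
        using dist_triangle3[of "Z (\<rho> \<omega>) \<omega>" "Z (\<sigma> \<omega>) \<omega>" "Z (\<sigma> \<omega> + (l + d)) \<omega>"]
        by (auto simp: A_def B_def add.assoc)
    qed
    then have "(\<Sum>d\<in>{1..D}. 1) \<le> (\<Sum>d\<in>{1..D}. indicator (B d) \<omega> + (indicator (A (l + d)) \<omega> :: real))"
      by (intro sum_mono)
    \<comment> \<open>Shifting by the random lag \<open>l \<le> D\<close> sends \<open>1..D\<close>
      into \<open>1..2 * D\<close>, which is why lags up to \<open>2 * D\<close> are controlled. The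
      two sums have \<open>D\<close> and \<open>2 * D\<close> terms, whence the factor 3.\<close>
    also have "\<dots> = (\<Sum>d\<in>{1..D}. indicator (B d) \<omega>) + (\<Sum>d\<in>(+) l ` {1..D}. indicator (A d) \<omega>)"
      by (subst sum.reindex) (auto simp: sum.distrib)
    also have "(\<Sum>d\<in>(+) l ` {1..D}. indicator (A d) \<omega> :: real) \<le> (\<Sum>d\<in>{1..2 * D}. indicator (A d) \<omega>)"
      using l by (intro sum_mono2) auto
    finally show ?thesis using True by simp
  qed (simp add: sum_nonneg)
  have int: "integrable M (indicator S :: _ \<Rightarrow> real)" if "S \<in> sets M" for S
    using that by (intro integrable_real_indicator) (auto simp: emeasure_eq_measure)
  have "real D * prob ?E = (\<integral>\<omega>. real D * indicator ?E \<omega> \<partial>M)"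
    using E sets.sets_into_space[OF E] by (simp add: Int_absorb1)
  also have "\<dots> \<le> (\<integral>\<omega>. (\<Sum>d\<in>{1..D}. indicator (B d) \<omega>) + (\<Sum>d\<in>{1..2 * D}. indicator (A d) \<omega>) \<partial>M)"
    by (intro integral_mono pt integrable_mult_right Bochner_Integration.integrable_add
        Bochner_Integration.integrable_sum int Am Bm E)
  also have "\<dots> = (\<Sum>d\<in>{1..D}. prob (B d)) + (\<Sum>d\<in>{1..2 * D}. prob (A d))"
    using sets.sets_into_space[OF Am] sets.sets_into_space[OF Bm]
    by (simp add: Bochner_Integration.integral_add integral_sum int Int_absorb1)
  also have "\<dots> \<le> (\<Sum>d\<in>{1..D}. \<eta>) + (\<Sum>d\<in>{1..2 * D}. \<eta>)"
    using le_\<sigma> le_\<rho> by (intro add_mono sum_mono) (auto simp: A_def B_def)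
  also have "\<dots> = real D * (3 * \<eta>)" by (simp add: algebra_simps)
  finally show ?thesis using D by simp
qed

text \<open>On the event, the first \<open>q\<close> gaps add up to at most \<open>N\<close>. A gap
  longer than \<open>D\<close> contributes at least 1 to the sum of all gaps divided by
  \<open>D\<close>, and any other gap is counted by an indicator. So \<open>q\<close> is at most
  \<open>N / D\<close> plus the number of short gaps; integrate and divide by
  \<open>q\<close>.\<close>

lemma prob_increasing_times_less:
  fixes \<tau> :: "nat \<Rightarrow> 'a \<Rightarrow> nat"
  assumes \<tau>[measurable]: "\<And>k. \<tau> k \<in> M \<rightarrow>\<^sub>M count_space UNIV"
    and mono: "\<And>k \<omega>. \<tau> k \<omega> \<le> \<tau> (Suc k) \<omega>"
    and q: "0 < q" and D: "0 < D"
    and short: "\<And>k. k < q \<Longrightarrow>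
      prob {\<omega> \<in> space M. \<tau> (Suc k) \<omega> < N \<and> \<tau> (Suc k) \<omega> \<le> \<tau> k \<omega> + D} \<le> \<eta>"
  shows "prob {\<omega> \<in> space M. \<tau> q \<omega> < N} \<le> real N / (real q * real D) + \<eta>"
    (is "prob ?E \<le> _")
proof -
  have [measurable]: "Measurable.pred M (\<lambda>\<omega>. \<tau> (Suc k) \<omega> < N \<and> \<tau> (Suc k) \<omega> \<le> \<tau> k \<omega> + D)" for k
    by (rule measurable_pred_countable2[OF \<tau> \<tau>, of "\<lambda>i j. i < N \<and> i \<le> j + D"])
  have [measurable]: "Measurable.pred M (\<lambda>\<omega>. \<tau> q \<omega> < N)"
    by (rule measurable_pred_countable2[OF \<tau> \<tau>, of "\<lambda>i j. i < N"])
  define A where "A k = {\<omega> \<in> space M. \<tau> (Suc k) \<omega> < N \<and> \<tau> (Suc k) \<omega> \<le> \<tau> k \<omega> + D}" for k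
  have Am[measurable]: "A k \<in> sets M" for k
    unfolding A_def by measurable
  have E[measurable]: "?E \<in> sets M" by measurable
  have le: "\<tau> k \<omega> \<le> \<tau> l \<omega>" if "k \<le> l" for k l \<omega>
    using that mono by (rule lift_Suc_mono_le[rotated])
  have pt: "real q * indicator ?E \<omega> \<le> real N / real D + (\<Sum>k<q. indicator (A k) \<omega> :: real)" for \<omega>
  proof (cases "\<omega> \<in> ?E")
    case True
    have "1 \<le> (real (\<tau> (Suc k) \<omega>) - real (\<tau> k \<omega>)) / real D + (indicator (A k) \<omega> :: real)" if "k < q" for k
    proof (cases "\<omega> \<in> A k")
      case True
      then show ?thesis using mono[of k \<omega>] by simp
    next
      case False
      have "\<tau> (Suc k) \<omega> < N" using True le[of "Suc k" q \<omega>] that by simp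
      with False True have "\<tau> k \<omega> + D < \<tau> (Suc k) \<omega>" by (simp add: A_def)
      then have "real D \<le> real (\<tau> (Suc k) \<omega>) - real (\<tau> k \<omega>)" by linarith
      with D False show ?thesis by simp
    qed
    then have "(\<Sum>k<q. 1) \<le> (\<Sum>k<q. (real (\<tau> (Suc k) \<omega>) - real (\<tau> k \<omega>)) / real D + (indicator (A k) \<omega> :: real))"
      by (intro sum_mono) auto
    also have "\<dots> = (real (\<tau> q \<omega>) - real (\<tau> 0 \<omega>)) / real D + (\<Sum>k<q. indicator (A k) \<omega>)"
      by (simp add: sum.distrib sum_divide_distrib[symmetric] sum_lessThan_telescope[where f="\<lambda>k. real (\<tau> k \<omega>)"])
    also have "(real (\<tau> q \<omega>) - real (\<tau> 0 \<omega>)) / real D \<le> real N / real D"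
      using True by (intro divide_right_mono) auto
    finally show ?thesis using True by simp
  qed (simp add: sum_nonneg)
  have int: "integrable M (indicator S :: _ \<Rightarrow> real)" if "S \<in> sets M" for S
    using that by (intro integrable_real_indicator) (auto simp: emeasure_eq_measure)
  have "real q * prob ?E = (\<integral>\<omega>. real q * indicator ?E \<omega> \<partial>M)"
    using E sets.sets_into_space[OF E] by (simp add: Int_absorb1)
  also have "\<dots> \<le> (\<integral>\<omega>. real N / real D + (\<Sum>k<q. indicator (A k) \<omega>) \<partial>M)"
    by (rule integral_mono) (auto intro!: int integrable_mult_right Am E simp: pt)
  also have "\<dots> = real N / real D + (\<Sum>k<q. prob (A k))"
    using sets.sets_into_space[OF Am]
    by (simp add: Bochner_Integration.integral_add integral_sum int Int_absorb1 prob_space)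
  also have "\<dots> \<le> real N / real D + (\<Sum>k<q. \<eta>)"
    using short by (intro add_mono sum_mono) (auto simp: A_def)
  also have "\<dots> = real q * (real N / (real q * real D) + \<eta>)" using q by (simp add: field_simps)
  finally show ?thesis using q by simp
qed

text \<open>Two scales are at work. A gap of at most \<open>D\<^sub>1\<close> that ends before
  \<open>N\<close> is unlikely, so \<open>q\<close> exits hardly fit before \<open>N\<close>. Asking
  that none of the \<open>q\<close> gaps be short costs a factor \<open>q\<close>, which the
  separate bound \<open>\<eta>\<^sub>2\<close> at scale \<open>D\<^sub>2\<close> can absorb. There
  the jump is required explicitly, because the last exit may merely be the horizon.\<close>

lemma prob_exits_not_far_apart:
  fixes Z :: "nat \<Rightarrow> 'a \<Rightarrow> 'b::{metric_space, second_countable_topology}"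
    and a :: real and N :: nat
  defines "\<tau> \<equiv> \<lambda>k \<omega>. exit_time N (2 * a) (\<lambda>j. Z j \<omega>) k"
  assumes Z[measurable]: "\<And>k. Z k \<in> borel_measurable M"
    and \<tau>[measurable]: "\<And>k. \<tau> k \<in> M \<rightarrow>\<^sub>M count_space UNIV"
    and q: "0 < q" and D\<^sub>1: "0 < D\<^sub>1" and D\<^sub>2: "0 < D\<^sub>2"
    and le1: "\<And>k d. 0 < d \<Longrightarrow> d \<le> 2 * D\<^sub>1 \<Longrightarrow>
      prob {\<omega> \<in> space M. a < dist (Z (\<tau> k \<omega> + d) \<omega>) (Z (\<tau> k \<omega>) \<omega>)} \<le> \<eta>\<^sub>1"
    and le2: "\<And>k d. 0 < d \<Longrightarrow> d \<le> 2 * D\<^sub>2 \<Longrightarrow>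
      prob {\<omega> \<in> space M. a < dist (Z (\<tau> k \<omega> + d) \<omega>) (Z (\<tau> k \<omega>) \<omega>)} \<le> \<eta>\<^sub>2"
  shows "\<exists>B\<in>events. {\<omega> \<in> space M. \<tau> q \<omega> < N \<or> (\<exists>k<q. \<tau> (Suc k) \<omega> \<le> \<tau> k \<omega> + D\<^sub>2 \<and>
      2 * a < dist (Z (\<tau> (Suc k) \<omega>) \<omega>) (Z (\<tau> k \<omega>) \<omega>))} \<subseteq> B \<and>
    prob B \<le> real N / (real q * real D\<^sub>1) + 3 * \<eta>\<^sub>1 + real q * (3 * \<eta>\<^sub>2)"
proof -
  have mono: "\<tau> k \<omega> \<le> \<tau> (Suc k) \<omega>" for k \<omega>
    unfolding \<tau>_def by (rule exit_time_mono)
  have exceeds: "2 * a < dist (Z (\<tau> (Suc k) \<omega>) \<omega>) (Z (\<tau> k \<omega>) \<omega>)" if "\<tau> (Suc k) \<omega> < N" for k \<omega>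
    using that next_exit_exceeds(2)[of N "2 * a" "\<lambda>j. Z j \<omega>" "\<tau> k \<omega>"] by (simp add: \<tau>_def)
  have Zc[measurable]: "(\<lambda>\<omega>. Z (\<tau> k \<omega>) \<omega>) \<in> borel_measurable M" for k
    by (rule measurable_compose_countable[OF Z \<tau>])
  have [measurable]: "Measurable.pred M (\<lambda>\<omega>. \<tau> k \<omega> \<le> \<tau> (Suc k) \<omega> \<and> \<tau> (Suc k) \<omega> \<le> \<tau> k \<omega> + D)" for k D
    by (rule measurable_pred_countable2[OF \<tau> \<tau>, of "\<lambda>i j. j \<le> i \<and> i \<le> j + D"])
  have [measurable]: "Measurable.pred M (\<lambda>\<omega>. \<tau> q \<omega> < N)"
    by (rule measurable_pred_countable2[OF \<tau> \<tau>, of "\<lambda>i j. i < N"])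
  define S where "S D k = {\<omega> \<in> space M. (\<tau> k \<omega> \<le> \<tau> (Suc k) \<omega> \<and> \<tau> (Suc k) \<omega> \<le> \<tau> k \<omega> + D) \<and>
      2 * a < dist (Z (\<tau> (Suc k) \<omega>) \<omega>) (Z (\<tau> k \<omega>) \<omega>)}" for D k
  have Sm[measurable]: "S D k \<in> sets M" for D k
    unfolding S_def by measurable
  have S1: "prob (S D\<^sub>1 k) \<le> 3 * \<eta>\<^sub>1" for k
    unfolding S_def conj_assoc using prob_jump_between_close_times[of Z "\<tau> k" "\<tau> (Suc k)" D\<^sub>1 a \<eta>\<^sub>1] Z \<tau> D\<^sub>1 le1 by blast
  have S2: "prob (S D\<^sub>2 k) \<le> 3 * \<eta>\<^sub>2" for k
    unfolding S_def conj_assoc using prob_jump_between_close_times[of Z "\<tau> k" "\<tau> (Suc k)" D\<^sub>2 a \<eta>\<^sub>2] Z \<tau> D\<^sub>2 le2 by blast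
  have "prob {\<omega> \<in> space M. \<tau> q \<omega> < N} \<le> real N / (real q * real D\<^sub>1) + 3 * \<eta>\<^sub>1"
  proof (rule prob_increasing_times_less[where \<tau> = \<tau>, OF \<tau> mono q D\<^sub>1])
    fix k
    have "{\<omega> \<in> space M. \<tau> (Suc k) \<omega> < N \<and> \<tau> (Suc k) \<omega> \<le> \<tau> k \<omega> + D\<^sub>1} \<subseteq> S D\<^sub>1 k"
      using mono exceeds by (auto simp: S_def)
    then show "prob {\<omega> \<in> space M. \<tau> (Suc k) \<omega> < N \<and> \<tau> (Suc k) \<omega> \<le> \<tau> k \<omega> + D\<^sub>1} \<le> 3 * \<eta>\<^sub>1"
      using finite_measure_mono[OF _ Sm] S1 by (meson order_trans)
  qed
  moreover have "prob (\<Union>k<q. S D\<^sub>2 k) \<le> real q * (3 * \<eta>\<^sub>2)"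
  proof -
    have "prob (\<Union>k<q. S D\<^sub>2 k) \<le> (\<Sum>k<q. prob (S D\<^sub>2 k))"
      by (rule finite_measure_subadditive_finite) auto
    also have "\<dots> \<le> (\<Sum>k<q. 3 * \<eta>\<^sub>2)" using S2 by (intro sum_mono)
    finally show ?thesis by simp
  qed
  moreover have "prob ({\<omega> \<in> space M. \<tau> q \<omega> < N} \<union> (\<Union>k<q. S D\<^sub>2 k))
      \<le> prob {\<omega> \<in> space M. \<tau> q \<omega> < N} + prob (\<Union>k<q. S D\<^sub>2 k)"
    by (rule measure_Un_le) auto
  moreover have "{\<omega> \<in> space M. \<tau> q \<omega> < N} \<union> (\<Union>k<q. S D\<^sub>2 k) \<in> events"
    by auto
  ultimately show ?thesis
    by (intro bexI[of _ "{\<omega> \<in> space M. \<tau> q \<omega> < N} \<union> (\<Union>k<q. S D\<^sub>2 k)"])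
      (auto simp: S_def mono)
qed

end

section \<open>Aldous' condition and the modulus of continuity\<close>

text \<open>Says that the modulus of continuity of \<open>f\<close> on \<open>{0..T}\<close> at
  scale \<open>\<delta>\<close> exceeds \<open>e\<close>, without forming a supremum.\<close>

definition oscillates :: "real \<Rightarrow> (real \<Rightarrow> 'a::metric_space) \<Rightarrow> real \<Rightarrow> real \<Rightarrow> bool" where
  "oscillates T f \<delta> e \<longleftrightarrow> (\<exists>s\<in>{0..T}. \<exists>t\<in>{0..T}. dist s t < \<delta> \<and> e < dist (f s) (f t))"

lemma oscillates_mono: "oscillates T f \<delta> e \<Longrightarrow> \<delta> \<le> \<delta>' \<Longrightarrow> oscillates T f \<delta>' e"
  unfolding oscillates_def by (meson order_less_le_trans)

lemma not_oscillates_if_continuous: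
  assumes "continuous_on {0..T} f" "0 < e"
  shows "\<exists>\<delta>>0. \<not> oscillates T f \<delta> e"
proof -
  have "uniformly_continuous_on {0..T} f"
    using assms(1) by (rule compact_uniformly_continuous) simp
  then obtain \<delta> where "\<delta> > 0" "\<And>s t. s \<in> {0..T} \<Longrightarrow> t \<in> {0..T} \<Longrightarrow> dist t s < \<delta> \<Longrightarrow> dist (f t) (f s) < e"
    using assms(2) unfolding uniformly_continuous_on_def by metis
  then show ?thesis
    unfolding oscillates_def by (meson less_asym)
qed

text \<open>Both inequalities are strict, so by continuity the witnesses can be moved into
  \<open>Q\<close>. For countable \<open>Q\<close> this makes oscillation a measurable
  event.\<close>

lemma oscillates_dense_iff:
  assumes f: "continuous_on {0..T} f" and Q: "Q \<subseteq> {0..T}" "{0..T} \<subseteq> closure Q"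
  shows "oscillates T f \<delta> e \<longleftrightarrow> (\<exists>s\<in>Q. \<exists>t\<in>Q. dist s t < \<delta> \<and> e < dist (f s) (f t))"
proof
  assume "oscillates T f \<delta> e"
  then obtain s t where st: "s \<in> {0..T}" "t \<in> {0..T}" "dist s t < \<delta>" "e < dist (f s) (f t)"
    unfolding oscillates_def by blast
  have "s \<in> closure Q" "t \<in> closure Q" using Q st by auto
  then obtain u v where u: "\<And>n. u n \<in> Q" "u \<longlonglongrightarrow> s" and v: "\<And>n. v n \<in> Q" "v \<longlonglongrightarrow> t"
    unfolding closure_sequential by auto
  have mem: "u n \<in> {0..T}" "v n \<in> {0..T}" for n using u(1) v(1) Q(1) by blast+
  have lim: "(\<lambda>n. f (u n)) \<longlonglongrightarrow> f s" "(\<lambda>n. f (v n)) \<longlonglongrightarrow> f t"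
    by (rule continuous_on_tendsto_compose[OF f u(2) st(1)] continuous_on_tendsto_compose[OF f v(2) st(2)];
        simp only: mem eventually_True)+
  have "\<forall>\<^sub>F n in sequentially. dist (u n) (v n) < \<delta>"
    using tendsto_dist[OF u(2) v(2)] st by (auto dest: order_tendstoD)
  moreover have "\<forall>\<^sub>F n in sequentially. e < dist (f (u n)) (f (v n))"
    using tendsto_dist[OF lim] st by (auto dest: order_tendstoD)
  ultimately have "\<forall>\<^sub>F n in sequentially. dist (u n) (v n) < \<delta> \<and> e < dist (f (u n)) (f (v n))"
    by (rule eventually_conj)
  then obtain n where "dist (u n) (v n) < \<delta> \<and> e < dist (f (u n)) (f (v n))"
    using eventually_happens'[OF sequentially_bot] by blast
  then show "\<exists>s\<in>Q. \<exists>t\<in>Q. dist s t < \<delta> \<and> e < dist (f s) (f t)"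
    using u(1) v(1) by blast
qed (use Q in \<open>auto simp: oscillates_def\<close>)

lemma sets_oscillates:
  fixes X :: "'w \<Rightarrow> real \<Rightarrow> 'b::{metric_space, second_countable_topology}"
  assumes X: "\<And>t. t \<in> {0..T} \<Longrightarrow> (\<lambda>\<omega>. X \<omega> t) \<in> borel_measurable M"
    and cont: "\<And>\<omega>. \<omega> \<in> space M \<Longrightarrow> continuous_on {0..T} (X \<omega>)"
  shows "{\<omega> \<in> space M. oscillates T (X \<omega>) \<delta> e} \<in> sets M"
proof -
  obtain Q where Q: "countable Q" "Q \<subseteq> {0..T}" "{0..T} \<subseteq> closure Q"
    using separable[of "{0..T}"] by blast
  have eq: "{\<omega> \<in> space M. oscillates T (X \<omega>) \<delta> e} =
      (\<Union>s\<in>Q. \<Union>t\<in>{t \<in> Q. dist s t < \<delta>}. {\<omega> \<in> space M. e < dist (X \<omega> s) (X \<omega> t)})"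
    using oscillates_dense_iff[OF cont Q(2,3)] by auto blast+
  have "{\<omega> \<in> space M. e < dist (X \<omega> s) (X \<omega> t)} \<in> sets M" if "s \<in> Q" "t \<in> Q" for s t
    using X Q that by (intro borel_measurable_less borel_measurable_dist) auto
  then show ?thesis
    unfolding eq using Q(1) by (intro sets.countable_UN') auto
qed

text \<open>As the scale shrinks, the oscillation events decrease to the empty set, since each path
  is uniformly continuous; continuity from above concludes. The scale depends on the process: the
  lemma serves to exclude small lags, and to choose a grid, for one process at a time.\<close>

lemma (in prob_space) prob_oscillates_small:
  fixes X :: "'a \<Rightarrow> real \<Rightarrow> 'b::{metric_space, second_countable_topology}"
  assumes X: "\<And>t. t \<in> {0..T} \<Longrightarrow> (\<lambda>\<omega>. X \<omega> t) \<in> borel_measurable M"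
    and cont: "\<And>\<omega>. \<omega> \<in> space M \<Longrightarrow> continuous_on {0..T} (X \<omega>)"
    and e: "0 < e" and p: "0 < p"
  shows "\<exists>\<delta>>0. prob {\<omega> \<in> space M. oscillates T (X \<omega>) \<delta> e} \<le> p"
proof -
  define A where "A m = {\<omega> \<in> space M. oscillates T (X \<omega>) (inverse (real (Suc m))) e}" for m
  have "(\<lambda>m. prob (A m)) \<longlonglongrightarrow> prob (\<Inter>m. A m)"
  proof (rule finite_Lim_measure_decseq)
    show "range A \<subseteq> events"
      using sets_oscillates[OF X cont] by (auto simp: A_def)
    show "decseq A"
      by (rule decseq_SucI) (auto simp: A_def intro: oscillates_mono[OF _ le_imp_inverse_le])
  qed
  moreover have "(\<Inter>m. A m) = {}"
  proof (rule ccontr)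
    assume "(\<Inter>m. A m) \<noteq> {}"
    then obtain \<omega> where \<omega>: "\<And>m. \<omega> \<in> A m" by auto
    then obtain \<delta> where \<delta>: "\<delta> > 0" "\<not> oscillates T (X \<omega>) \<delta> e"
      using not_oscillates_if_continuous[OF cont e, of \<omega>] by (auto simp: A_def)
    obtain m where "inverse (real (Suc m)) < \<delta>" using reals_Archimedean[OF \<delta>(1)] by blast
    with \<omega>[of m] \<delta>(2) show False
      by (auto simp: A_def dest: oscillates_mono[OF _ less_imp_le])
  qed
  ultimately have "(\<lambda>m. prob (A m)) \<longlonglongrightarrow> 0" by simp
  then have "\<forall>\<^sub>F m in sequentially. prob (A m) < p" using p by (rule order_tendstoD)
  then obtain m where "prob (A m) < p" by (auto simp: eventually_sequentially)
  then show ?thesis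
    by (intro exI[of _ "inverse (real (Suc m))"]) (auto simp: A_def)
qed

text \<open>Induction on the number of exits. Given the position \<open>i\<close> of the previous
  exit, \<open>next_exit_eq_iff\<close> describes the event through values of \<open>Z\<close> up to
  time \<open>j\<close>.\<close>

lemma exit_time_adapted:
  fixes G :: "nat \<Rightarrow> 'w measure" and Z :: "nat \<Rightarrow> 'w \<Rightarrow> 'b::{metric_space, second_countable_topology}"
  assumes G: "\<And>i j. i \<le> j \<Longrightarrow> subalgebra (G j) (G i)"
    and Z: "\<And>i. Z i \<in> borel_measurable (G i)"
  shows "{\<omega> \<in> space (G 0). exit_time N e (\<lambda>j. Z j \<omega>) k = j} \<in> sets (G j)"
proof (induction k arbitrary: j)
  case 0
  have "space (G 0) = space (G j)" using G[of 0 j] by (simp add: subalgebra_def)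
  then show ?case by simp
next
  case (Suc k)
  define \<tau> where "\<tau> \<omega> = exit_time N e (\<lambda>j. Z j \<omega>) k" for \<omega>
  define \<rho> where "\<rho> \<omega> = exit_time N e (\<lambda>j. Z j \<omega>) (Suc k)" for \<omega>
  have sp: "space (G j) = space (G 0)" for j using G[of 0 j] by (simp add: subalgebra_def)
  have sub: "A \<in> sets (G j)" if "A \<in> sets (G i)" "i \<le> j" for A i j
    using that G[of i j] by (auto simp: subalgebra_def)
  have Zm: "Z i \<in> borel_measurable (G j)" if "i \<le> j" for i j
    using measurable_from_subalg[OF G[OF that] Z] .
  have \<rho>: "\<rho> \<omega> = next_exit N e (\<lambda>j. Z j \<omega>) (\<tau> \<omega>)" for \<omega> by (simp add: \<rho>_def \<tau>_def)
  have less: "{\<omega> \<in> space (G 0). \<rho> \<omega> = j} \<in> sets (G j)" if j: "j < N" for j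
  proof -
    define E where "E i = {\<omega> \<in> space (G j). e < dist (Z j \<omega>) (Z i \<omega>) \<and>
        (\<forall>l\<in>{i<..<j}. dist (Z l \<omega>) (Z i \<omega>) \<le> e)}" for i
    have eq: "{\<omega> \<in> space (G 0). \<rho> \<omega> = j} = (\<Union>i<j. {\<omega> \<in> space (G 0). \<tau> \<omega> = i} \<inter> E i)"
      unfolding \<rho> next_exit_eq_iff[OF j] E_def sp[of j] by blast
    have "E i \<in> sets (G j)" if "i < j" for i
      unfolding E_def using that Zm
      by (intro sets.sets_Collect_conj sets.sets_Collect_finite_All
          borel_measurable_less borel_measurable_le borel_measurable_dist) auto
    moreover have "{\<omega> \<in> space (G 0). \<tau> \<omega> = i} \<in> sets (G j)" if "i < j" for i
      using sub[OF Suc.IH[of i]] that by (simp add: \<tau>_def)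
    ultimately show ?thesis
      unfolding eq by (intro sets.finite_UN sets.Int) auto
  qed
  have "{\<omega> \<in> space (G 0). \<rho> \<omega> = j} \<in> sets (G j)"
  proof (cases "j < N")
    case False
    have le: "\<rho> \<omega> \<le> N" for \<omega> unfolding \<rho> by (rule next_exit_le)
    \<comment> \<open>At the horizon the event is the complement of all earlier exits; beyond it the
      event is empty.\<close>
    have "{\<omega> \<in> space (G 0). \<rho> \<omega> = j} = (if j = N then space (G j) - (\<Union>i<N. {\<omega> \<in> space (G 0). \<rho> \<omega> = i}) else {})"
    proof (intro set_eqI)
      fix \<omega>
      show "\<omega> \<in> {\<omega> \<in> space (G 0). \<rho> \<omega> = j} \<longleftrightarrow>
          \<omega> \<in> (if j = N then space (G j) - (\<Union>i<N. {\<omega> \<in> space (G 0). \<rho> \<omega> = i}) else {})"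
        using le[of \<omega>] False sp[of j] by (cases "\<rho> \<omega> < N") auto
    qed
    moreover have "{\<omega> \<in> space (G 0). \<rho> \<omega> = i} \<in> sets (G j)" if "i < N" for i
      using sub[OF less[OF that]] that False by simp
    ultimately show ?thesis by auto
  qed (rule less)
  then show ?case by (simp add: \<rho>_def)
qed

section \<open>Uniform modulus of continuity from increments at stopping times\<close>

context filtered_prob_space
begin

lemma measurable_from_F: "f \<in> borel_measurable (F t) \<Longrightarrow> 0 \<le> t \<Longrightarrow> f \<in> borel_measurable M"
  using measurable_from_subalg subalgebra_F by blast

lemma subalgebra_F_mono: "0 \<le> s \<Longrightarrow> s \<le> t \<Longrightarrow> subalgebra (F t) (F s)"
  using subalgebra_F[of s] subalgebra_F[of t] F_mono[of s t] by (auto simp: subalgebra_def)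

lemma space_F: "0 \<le> t \<Longrightarrow> space (F t) = space M"
  using subalgebra_F by (simp add: subalgebra_def)

text \<open>The event of having stopped by \<open>t\<close> is a finite union of events
  \<open>\<sigma> = k\<close>, each known at its grid time \<open>h * k \<le> t\<close>.\<close>

lemma nonneg_stopping_time_grid:
  assumes h: "0 \<le> h" and \<sigma>: "\<And>k. {\<omega> \<in> space M. \<sigma> \<omega> = k} \<in> sets (F (h * real k))"
    and le: "\<And>\<omega>. \<sigma> \<omega> \<le> N"
  shows "nonneg_stopping_time F (\<lambda>\<omega>. h * real (\<sigma> \<omega>))"
  unfolding nonneg_stopping_time_def stopping_time_def pred_def
proof
  fix t :: real
  have eq: "{\<omega> \<in> space (F (max 0 t)). h * real (\<sigma> \<omega>) \<le> t} =
      (\<Union>k\<in>{k. k \<le> N \<and> h * real k \<le> t}. {\<omega> \<in> space M. \<sigma> \<omega> = k})"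
    using le by (auto simp: space_F)
  have "{\<omega> \<in> space M. \<sigma> \<omega> = k} \<in> sets (F (max 0 t))" if "h * real k \<le> t" for k
  proof -
    have "h * real k \<le> max 0 t" using that by linarith
    then show ?thesis using \<sigma>[of k] F_mono[of "h * real k" "max 0 t"] h by auto
  qed
  then show "{\<omega> \<in> space (F (max 0 t)). h * real (\<sigma> \<omega>) \<le> t} \<in> sets (F (max 0 t))"
    unfolding eq by (intro sets.finite_UN) auto
qed

text \<open>A sequence of stopping times that nearly minimises, for each \<open>n\<close>, the lag \<open>\<delta>\<close> at which a large
  increment is likely already witnesses every failure of uniformity; for each single \<open>n\<close> the
  minimal lag is positive by uniform continuity of the paths.\<close>

lemma uniform_over_stopping_times:
  fixes Y :: "nat \<Rightarrow> 'w \<Rightarrow> real \<Rightarrow> 'b::{metric_space, second_countable_topology}"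
  assumes T: "0 < T"
    and adapted: "\<And>n t. t \<in> {0..T} \<Longrightarrow> (\<lambda>\<omega>. Y n \<omega> t) \<in> borel_measurable (F t)"
    and cont: "\<And>n \<omega>. \<omega> \<in> space M \<Longrightarrow> continuous_on {0..T} (Y n \<omega>)"
    and lim: "\<And>\<gamma>. (\<And>n. nonneg_stopping_time F (\<gamma> n)) \<Longrightarrow>
      (\<And>n \<omega>. \<omega> \<in> space M \<Longrightarrow> \<gamma> n \<omega> \<in> {0..T}) \<Longrightarrow>
      ((\<lambda>\<delta>. SUP n. \<P>(\<omega> in M. e < dist (Y n \<omega> (min (\<gamma> n \<omega> + \<delta>) T)) (Y n \<omega> (\<gamma> n \<omega>)))) \<longlongrightarrow> 0) (at_right 0)"
    and e: "0 < e" and \<eta>: "0 < \<eta>"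
  shows "\<exists>\<delta>\<^sub>0>0. \<forall>n \<gamma> \<delta>. nonneg_stopping_time F \<gamma> \<longrightarrow> (\<forall>\<omega>\<in>space M. \<gamma> \<omega> \<in> {0..T}) \<longrightarrow> 0 < \<delta> \<longrightarrow> \<delta> \<le> \<delta>\<^sub>0 \<longrightarrow>
    \<P>(\<omega> in M. e < dist (Y n \<omega> (min (\<gamma> \<omega> + \<delta>) T)) (Y n \<omega> (\<gamma> \<omega>))) \<le> \<eta>"
proof (rule ccontr)
  define stop where "stop \<gamma> \<longleftrightarrow> nonneg_stopping_time F \<gamma> \<and> (\<forall>\<omega>\<in>space M. \<gamma> \<omega> \<in> {0..T})" for \<gamma>
  define P where "P n \<gamma> \<delta> = \<P>(\<omega> in M. e < dist (Y n \<omega> (min (\<gamma> \<omega> + \<delta>) T)) (Y n \<omega> (\<gamma> \<omega>)))" for n \<gamma> \<delta>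
  define bad where "bad n = {\<delta>. 0 < \<delta> \<and> (\<exists>\<gamma>. stop \<gamma> \<and> \<eta> < P n \<gamma> \<delta>)}" for n
  assume "\<not> ?thesis"
  then have neg: "\<exists>n. \<exists>\<delta>\<in>bad n. \<delta> \<le> \<delta>\<^sub>0" if "0 < \<delta>\<^sub>0" for \<delta>\<^sub>0
    using that unfolding bad_def P_def stop_def by (simp add: not_le) blast
  have zero: "stop (\<lambda>_. 0)"
    using T by (simp add: stop_def nonneg_stopping_time_def stopping_time_const)
  \<comment> \<open>For each \<open>n\<close>, one stopping time and one lag \<open>d\<close>
    represent all bad lags: \<open>d\<close> is itself bad and at most twice any other. If there are
    no bad lags the claim is vacuous, and the constant time 0 fills the slot.\<close>
  have "\<exists>\<gamma> d. stop \<gamma> \<and> (\<forall>\<delta>\<in>bad n. 0 < d \<and> \<eta> < P n \<gamma> d \<and> d \<le> 2 * \<delta>)" for n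
  proof (cases "bad n = {}")
    case True
    with zero show ?thesis by auto
  next
    case False
    have Ym: "\<And>t. t \<in> {0..T} \<Longrightarrow> (\<lambda>\<omega>. Y n \<omega> t) \<in> borel_measurable M"
      using measurable_from_F[OF adapted] by simp
    obtain \<delta>' where \<delta>': "0 < \<delta>'" "prob {\<omega> \<in> space M. oscillates T (Y n \<omega>) \<delta>' e} \<le> \<eta>"
      using prob_oscillates_small[OF Ym cont e \<eta>] by blast
    have lower: "\<delta>' \<le> \<delta>" if \<delta>: "\<delta> \<in> bad n" for \<delta>
    proof (rule ccontr)
      assume "\<not> \<delta>' \<le> \<delta>"
      obtain \<gamma> where \<gamma>: "stop \<gamma>" "\<eta> < P n \<gamma> \<delta>" "0 < \<delta>" using \<delta> by (auto simp: bad_def)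
      have "oscillates T (Y n \<omega>) \<delta>' e"
        if "\<omega> \<in> space M" "e < dist (Y n \<omega> (min (\<gamma> \<omega> + \<delta>) T)) (Y n \<omega> (\<gamma> \<omega>))" for \<omega>
        unfolding oscillates_def
      proof (intro bexI conjI)
        have "\<gamma> \<omega> \<in> {0..T}" using \<gamma>(1) that(1) by (auto simp: stop_def)
        then show "dist (min (\<gamma> \<omega> + \<delta>) T) (\<gamma> \<omega>) < \<delta>'" "min (\<gamma> \<omega> + \<delta>) T \<in> {0..T}" "\<gamma> \<omega> \<in> {0..T}"
          using \<gamma>(3) \<open>\<not> \<delta>' \<le> \<delta>\<close> by (auto simp: dist_real_def)
      qed (rule that)
      then have "P n \<gamma> \<delta> \<le> prob {\<omega> \<in> space M. oscillates T (Y n \<omega>) \<delta>' e}"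
        unfolding P_def by (intro finite_measure_mono sets_oscillates[OF Ym cont]) auto
      with \<gamma>(2) \<delta>'(2) show False by simp
    qed
    \<comment> \<open>The infimum is positive, so some bad lag lies below twice its value.\<close>
    have pos: "\<delta>' \<le> Inf (bad n)" using False lower by (intro cInf_greatest)
    then obtain d where d: "d \<in> bad n" "d < 2 * Inf (bad n)"
      using cInf_lessD[OF False, of "2 * Inf (bad n)"] \<delta>'(1) by auto
    obtain \<gamma> where "stop \<gamma>" "\<eta> < P n \<gamma> d" "0 < d" using d by (auto simp: bad_def)
    moreover have "d \<le> 2 * \<delta>" if "\<delta> \<in> bad n" for \<delta>
      using cInf_lower[OF that] lower d(2) by (force intro: bdd_belowI)
    ultimately show ?thesis by blast
  qed
  then obtain \<gamma> d where \<gamma>: "\<And>n. stop (\<gamma> n)"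
    and d: "\<And>n \<delta>. \<delta> \<in> bad n \<Longrightarrow> 0 < d n \<and> \<eta> < P n (\<gamma> n) (d n) \<and> d n \<le> 2 * \<delta>"
    by metis
  have "((\<lambda>\<delta>. SUP n. P n (\<gamma> n) \<delta>) \<longlongrightarrow> 0) (at_right 0)"
    unfolding P_def using \<gamma> by (intro lim) (auto simp: stop_def)
  then have "\<forall>\<^sub>F \<delta> in at_right 0. (SUP n. P n (\<gamma> n) \<delta>) < \<eta>"
    using \<eta> by (rule order_tendstoD)
  then obtain b where b: "0 < b" "\<And>\<delta>. 0 < \<delta> \<Longrightarrow> \<delta> < b \<Longrightarrow> (SUP n. P n (\<gamma> n) \<delta>) < \<eta>"
    unfolding eventually_at_right_field by blast
  \<comment> \<open>The quarter leaves room for the factor 2: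
    \<open>d n \<le> 2 * \<delta> \<le> b / 2 < b\<close>. At lag \<open>d n\<close> the supremum is
    then below \<open>\<eta>\<close>, while its \<open>n\<close>-th term exceeds
    \<open>\<eta>\<close>.\<close>
  obtain n \<delta> where "\<delta> \<in> bad n" "\<delta> \<le> b / 4" using neg[of "b / 4"] b(1) by auto
  then have dn: "0 < d n" "\<eta> < P n (\<gamma> n) (d n)" "d n < b" using d[of \<delta> n] b(1) by auto
  have "P n (\<gamma> n) (d n) \<le> (SUP m. P m (\<gamma> m) (d n))"
    by (rule cSUP_upper) (auto intro!: bdd_aboveI2[of _ _ 1] simp: P_def)
  with dn b(2)[of "d n"] show False by simp
qed

text \<open>The order of choices matters: \<open>\<delta>\<^sub>1\<close> from \<open>e\<close> and
  \<open>p\<close>, then the number \<open>q\<close> of exits from \<open>\<delta>\<^sub>1\<close>,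
  then \<open>\<delta>\<^sub>2\<close> from \<open>q\<close>, all uniform in \<open>n\<close>; only
  the grid depends on \<open>n\<close>. The budget \<open>p\<close> is spent in quarters: two on
  having \<open>q\<close> exits before the horizon, one on two exits being close, one on oscillation
  at the scale of the mesh.\<close>

lemma uniform_modulus_of_continuity:
  fixes Y :: "'i \<Rightarrow> 'w \<Rightarrow> real \<Rightarrow> 'b::{metric_space, second_countable_topology}"
  assumes T: "0 < T"
    and adapted: "\<And>n t. t \<in> {0..T} \<Longrightarrow> (\<lambda>\<omega>. Y n \<omega> t) \<in> borel_measurable (F t)"
    and cont: "\<And>n \<omega>. \<omega> \<in> space M \<Longrightarrow> continuous_on {0..T} (Y n \<omega>)"
    and small: "\<And>a \<eta>. 0 < a \<Longrightarrow> 0 < \<eta> \<Longrightarrow> \<exists>\<delta>\<^sub>0>0. \<forall>n \<gamma> \<delta>. nonneg_stopping_time F \<gamma> \<longrightarrow>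
      (\<forall>\<omega>\<in>space M. \<gamma> \<omega> \<in> {0..T}) \<longrightarrow> 0 < \<delta> \<longrightarrow> \<delta> \<le> \<delta>\<^sub>0 \<longrightarrow>
      \<P>(\<omega> in M. a < dist (Y n \<omega> (min (\<gamma> \<omega> + \<delta>) T)) (Y n \<omega> (\<gamma> \<omega>))) \<le> \<eta>"
    and e: "0 < e" and p: "0 < p"
  shows "\<exists>\<delta>>0. \<forall>n. prob {\<omega> \<in> space M. oscillates T (Y n \<omega>) \<delta> e} \<le> p"
proof -
  \<comment> \<open>With exit threshold \<open>2 * a\<close>, grid values at nearby times differ by
    at most \<open>4 * (2 * a)\<close>, and rounding each end point to the grid adds
    \<open>2 * a\<close>: in all \<open>12 * a = e\<close>.\<close>
  define a where "a = e / 12"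
  have a: "0 < a" using e by (simp add: a_def)
  obtain \<delta>\<^sub>1 where \<delta>\<^sub>1: "0 < \<delta>\<^sub>1" "\<And>n \<gamma> \<delta>. nonneg_stopping_time F \<gamma> \<Longrightarrow> (\<forall>\<omega>\<in>space M. \<gamma> \<omega> \<in> {0..T}) \<Longrightarrow>
      0 < \<delta> \<Longrightarrow> \<delta> \<le> \<delta>\<^sub>1 \<Longrightarrow> \<P>(\<omega> in M. a < dist (Y n \<omega> (min (\<gamma> \<omega> + \<delta>) T)) (Y n \<omega> (\<gamma> \<omega>))) \<le> p / 12"
    using small[OF a, of "p / 12"] p by auto
  \<comment> \<open>It will turn out that
    \<open>N / D\<^sub>1 \<le> 4 * T / \<delta>\<^sub>1\<close>; this \<open>q\<close> then makes
    \<open>N / (q * D\<^sub>1)\<close> at most \<open>p / 4\<close>.\<close>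
  obtain q :: nat where q: "16 * T / (\<delta>\<^sub>1 * p) < real q" using reals_Archimedean2 by blast
  have "0 < 16 * T / (\<delta>\<^sub>1 * p)" using T \<delta>\<^sub>1(1) p by simp
  with q have q0: "0 < q" by linarith
  obtain \<delta>\<^sub>2 where \<delta>\<^sub>2: "0 < \<delta>\<^sub>2" "\<And>n \<gamma> \<delta>. nonneg_stopping_time F \<gamma> \<Longrightarrow> (\<forall>\<omega>\<in>space M. \<gamma> \<omega> \<in> {0..T}) \<Longrightarrow>
      0 < \<delta> \<Longrightarrow> \<delta> \<le> \<delta>\<^sub>2 \<Longrightarrow> \<P>(\<omega> in M. a < dist (Y n \<omega> (min (\<gamma> \<omega> + \<delta>) T)) (Y n \<omega> (\<gamma> \<omega>))) \<le> p / (12 * real q)"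
    using small[OF a, of "p / (12 * real q)"] p q0 by auto
  have "prob {\<omega> \<in> space M. oscillates T (Y n \<omega>) (\<delta>\<^sub>2 / 4) e} \<le> p" for n
  proof -
    have Ym: "\<And>t. t \<in> {0..T} \<Longrightarrow> (\<lambda>\<omega>. Y n \<omega> t) \<in> borel_measurable M"
      using measurable_from_F[OF adapted] by simp
    obtain \<delta>' where \<delta>': "0 < \<delta>'" "prob {\<omega> \<in> space M. oscillates T (Y n \<omega>) \<delta>' (2 * a)} \<le> p / 4"
      using prob_oscillates_small[OF Ym cont, of "2 * a" "p / 4"] a p by auto
    \<comment> \<open>A mesh below \<open>\<delta>'\<close> makes a grid step, or rounding to the
      grid, cost at most \<open>2 * a\<close> off an event of probability at most
      \<open>p / 4\<close>. The other bounds give \<open>D\<^sub>1 \<ge> 1\<close> and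
      \<open>\<delta>\<^sub>2 / (2 * h) > 4\<close>.\<close>
    define m where "m = min \<delta>' (min (\<delta>\<^sub>1 / 2) (\<delta>\<^sub>2 / 8))"
    have m: "0 < m" using \<delta>'(1) \<delta>\<^sub>1(1) \<delta>\<^sub>2(1) by (simp add: m_def)
    obtain N :: nat where N: "T / m < real N" using reals_Archimedean2 by blast
    have N0: "0 < real N" using N divide_pos_pos[OF T m] by linarith
    define h where "h = T / real N"
    have h0: "0 < h" using T N0 by (simp add: h_def)
    have hN: "h * real N = T" using N0 by (simp add: h_def)
    have "h < m"
      using N m N0 by (simp add: h_def field_simps)
    then have h: "h < \<delta>'" "h < \<delta>\<^sub>1 / 2" "h < \<delta>\<^sub>2 / 8" by (auto simp: m_def)
    have le_T: "h * real i \<le> T" if "i \<le> N" for i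
      using mult_left_mono[of "real i" "real N" h] that h0 hN by simp
    \<comment> \<open>Halved so that grid lags up to \<open>2 * D\<^sub>1\<close> and
      \<open>2 * D\<^sub>2\<close> amount to at most \<open>\<delta>\<^sub>1\<close> and
      \<open>\<delta>\<^sub>2\<close> in real time.\<close>
    define D\<^sub>1 D\<^sub>2 where "D\<^sub>1 = nat \<lfloor>\<delta>\<^sub>1 / (2 * h)\<rfloor>" and "D\<^sub>2 = nat \<lfloor>\<delta>\<^sub>2 / (2 * h)\<rfloor>"
    have r: "1 < \<delta>\<^sub>1 / (2 * h)" "4 < \<delta>\<^sub>2 / (2 * h)" using h h0 by (auto simp: field_simps)
    have D\<^sub>1: "0 < D\<^sub>1" "real D\<^sub>1 \<le> \<delta>\<^sub>1 / (2 * h)"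
      using r unfolding D\<^sub>1_def by linarith+
    have "\<delta>\<^sub>1 / (2 * h) < real D\<^sub>1 + 1"
      using r unfolding D\<^sub>1_def by linarith
    with D\<^sub>1(1) have D\<^sub>1': "\<delta>\<^sub>1 / (2 * h) < 2 * real D\<^sub>1"
      by linarith
    have D\<^sub>2: "0 < D\<^sub>2" "real D\<^sub>2 \<le> \<delta>\<^sub>2 / (2 * h)" "\<delta>\<^sub>2 / (2 * h) - 1 < real D\<^sub>2"
      using r unfolding D\<^sub>2_def by linarith+
    \<comment> \<open>Freezing at \<open>T\<close> covers the indices \<open>\<tau> k + d\<close>
      beyond \<open>N\<close> and mirrors the \<open>min\<close> in the increment condition.\<close>
    define Z where "Z i \<omega> = Y n \<omega> (min (h * real i) T)" for i \<omega>
    define \<tau> where "\<tau> k \<omega> = exit_time N (2 * a) (\<lambda>j. Z j \<omega>) k" for k \<omega>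
    have ZF: "Z i \<in> borel_measurable (F (h * real i))" for i
      unfolding Z_def using h0 T
      by (intro measurable_from_subalg[OF subalgebra_F_mono adapted]) auto
    have Zm: "Z i \<in> borel_measurable M" for i
      using measurable_from_F[OF ZF] h0 by simp
    have \<tau>F: "{\<omega> \<in> space M. \<tau> k \<omega> = j} \<in> sets (F (h * real j))" for k j
      using exit_time_adapted[of "\<lambda>i. F (h * real i)" Z N "2 * a" k j] ZF h0 space_F[of 0]
      by (simp add: \<tau>_def subalgebra_F_mono)
    have \<tau>m: "\<tau> k \<in> M \<rightarrow>\<^sub>M count_space UNIV" for k
    proof (rule measurable_count_space_eq_countable[THEN iffD2], simp, intro conjI ballI)
      fix j
      have "\<tau> k -` {j} \<inter> space M = {\<omega> \<in> space M. \<tau> k \<omega> = j}" by auto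
      then show "\<tau> k -` {j} \<inter> space M \<in> events"
        using \<tau>F[of k j] subalgebra_F[of "h * real j"] h0 by (auto simp: subalgebra_def)
    qed simp
    have \<tau>N: "\<tau> k \<omega> \<le> N" for k \<omega> unfolding \<tau>_def by (rule exit_time_le)
    have stop: "nonneg_stopping_time F (\<lambda>\<omega>. h * real (\<tau> k \<omega>))" for k
      using h0 by (intro nonneg_stopping_time_grid[OF _ \<tau>F \<tau>N]) simp
    have range: "\<forall>\<omega>\<in>space M. h * real (\<tau> k \<omega>) \<in> {0..T}" for k
      using le_T[OF \<tau>N] h0 by simp
    have shift: "dist (Z (\<tau> k \<omega> + d) \<omega>) (Z (\<tau> k \<omega>) \<omega>) =
        dist (Y n \<omega> (min (h * real (\<tau> k \<omega>) + h * real d) T)) (Y n \<omega> (h * real (\<tau> k \<omega>)))" for k d \<omega>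
      using le_T[OF \<tau>N] by (simp add: Z_def distrib_left min_absorb1)
    have lag: "h * real d \<le> \<delta>" if "d \<le> 2 * D" "real D \<le> \<delta> / (2 * h)" for d D \<delta>
    proof -
      have "h * real d \<le> h * (2 * real D)" using that(1) h0 by (intro mult_left_mono) auto
      also have "\<dots> \<le> \<delta>" using that(2) h0 by (simp add: field_simps)
      finally show ?thesis .
    qed
    have "\<exists>B\<in>events. {\<omega> \<in> space M. \<tau> q \<omega> < N \<or> (\<exists>k<q. \<tau> (Suc k) \<omega> \<le> \<tau> k \<omega> + D\<^sub>2 \<and>
        2 * a < dist (Z (\<tau> (Suc k) \<omega>) \<omega>) (Z (\<tau> k \<omega>) \<omega>))} \<subseteq> B \<and>
        prob B \<le> real N / (real q * real D\<^sub>1) + 3 * (p / 12) + real q * (3 * (p / (12 * real q)))"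
      unfolding \<tau>_def
    proof (rule prob_exits_not_far_apart; (fold \<tau>_def)?)
      show "prob {\<omega> \<in> space M. a < dist (Z (\<tau> k \<omega> + d) \<omega>) (Z (\<tau> k \<omega>) \<omega>)} \<le> p / 12"
        if "0 < d" "d \<le> 2 * D\<^sub>1" for k d
        unfolding shift using lag[OF that(2) D\<^sub>1(2)] that(1) h0 by (intro \<delta>\<^sub>1(2) stop range) simp_all
      show "prob {\<omega> \<in> space M. a < dist (Z (\<tau> k \<omega> + d) \<omega>) (Z (\<tau> k \<omega>) \<omega>)} \<le> p / (12 * real q)"
        if "0 < d" "d \<le> 2 * D\<^sub>2" for k d
        unfolding shift using lag[OF that(2) D\<^sub>2(2)] that(1) h0 by (intro \<delta>\<^sub>2(2) stop range) simp_all
    qed (use Zm \<tau>m q0 D\<^sub>1 D\<^sub>2 in auto)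
    then obtain B where B: "B \<in> events" "{\<omega> \<in> space M. \<tau> q \<omega> < N \<or> (\<exists>k<q. \<tau> (Suc k) \<omega> \<le> \<tau> k \<omega> + D\<^sub>2 \<and>
        2 * a < dist (Z (\<tau> (Suc k) \<omega>) \<omega>) (Z (\<tau> k \<omega>) \<omega>))} \<subseteq> B"
      "prob B \<le> real N / (real q * real D\<^sub>1) + 3 * (p / 12) + real q * (3 * (p / (12 * real q)))"
      by blast
    have "real N / (real q * real D\<^sub>1) \<le> p / 4"
    proof -
      have "\<delta>\<^sub>1 < 4 * h * real D\<^sub>1" using D\<^sub>1' h0 by (simp add: field_simps)
      then have "\<delta>\<^sub>1 * real N \<le> (4 * h * real D\<^sub>1) * real N" by (intro mult_right_mono) auto
      also have "\<dots> = 4 * T * real D\<^sub>1" unfolding hN[symmetric] by (simp only: mult_ac)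
      finally have "\<delta>\<^sub>1 * real N \<le> 4 * T * real D\<^sub>1" .
      moreover have "16 * T < real q * (\<delta>\<^sub>1 * p)" using q \<delta>\<^sub>1(1) p by (simp add: pos_divide_less_eq)
      then have "16 * T * real D\<^sub>1 \<le> real q * (\<delta>\<^sub>1 * p) * real D\<^sub>1" by (intro mult_right_mono) auto
      ultimately have "\<delta>\<^sub>1 * (4 * real N) \<le> \<delta>\<^sub>1 * (p * (real q * real D\<^sub>1))"
        by (simp add: algebra_simps)
      then have "4 * real N \<le> p * (real q * real D\<^sub>1)" using \<delta>\<^sub>1(1) by simp
      then show ?thesis using q0 D\<^sub>1(1) by (simp add: field_simps)
    qed
    with B(3) have PB: "prob B \<le> 3 * p / 4" using q0 by (simp add: field_simps)
    have "{\<omega> \<in> space M. oscillates T (Y n \<omega>) (\<delta>\<^sub>2 / 4) e}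
        \<subseteq> B \<union> {\<omega> \<in> space M. oscillates T (Y n \<omega>) \<delta>' (2 * a)}"
    proof (intro subsetI CollectI, rule ccontr)
      fix \<omega> assume \<omega>: "\<omega> \<in> {\<omega> \<in> space M. oscillates T (Y n \<omega>) (\<delta>\<^sub>2 / 4) e}"
        and no: "\<omega> \<notin> B \<union> {\<omega> \<in> space M. oscillates T (Y n \<omega>) \<delta>' (2 * a)}"
      have near: "dist (Y n \<omega> s) (Y n \<omega> t) \<le> 2 * a" if "s \<in> {0..T}" "t \<in> {0..T}" "dist s t < \<delta>'" for s t
        using no \<omega> that unfolding oscillates_def by (auto simp: not_less[symmetric])
      have q': "\<tau> q \<omega> = N"
        using no \<omega> B(2) \<tau>N[of q \<omega>] by (auto simp: le_less)
      have far: "dist (Z (\<tau> (Suc k) \<omega>) \<omega>) (Z (\<tau> k \<omega>) \<omega>) \<le> 2 * a"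
        if "k < q" "\<tau> (Suc k) \<omega> \<le> \<tau> k \<omega> + D\<^sub>2" for k
        using no \<omega> B(2) that by (auto simp: not_less[symmetric])
      have grid: "dist (Z i \<omega>) (Z j \<omega>) \<le> 4 * (2 * a)" if "i \<le> j" "j \<le> N" "j \<le> i + D\<^sub>2" for i j
      proof (rule dist_le_if_exits_far_apart[of "2 * a" N "\<lambda>j. Z j \<omega>" q D\<^sub>2 i j])
        show "dist (Z (Suc j) \<omega>) (Z j \<omega>) \<le> 2 * a" if "j < N" for j
          unfolding Z_def using h0 h(1) le_T[of j] le_T[of "Suc j"] that T
          by (intro near) (auto simp: dist_real_def algebra_simps)
      qed (use a q' far that in \<open>auto simp: \<tau>_def\<close>)
      have le: "dist (Y n \<omega> s) (Y n \<omega> t) \<le> e"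
        if st: "s \<in> {0..T}" "t \<in> {0..T}" "s \<le> t" "t - s < \<delta>\<^sub>2 / 4" for s t
      proof -
        define i j where "i = nat \<lfloor>s / h\<rfloor>" and "j = nat \<lfloor>t / h\<rfloor>"
        have i: "real i \<le> s / h" "s / h < real i + 1" and j: "real j \<le> t / h" "t / h < real j + 1"
          using st h0 unfolding i_def j_def by (simp_all add: of_nat_nat)
        have ij: "i \<le> j" unfolding i_def j_def using st h0 by (intro nat_mono floor_mono divide_right_mono) auto
        have "t / h \<le> real N" using st h0 hN by (simp add: field_simps)
        with j have jN: "j \<le> N" by linarith
        \<comment> \<open>Rounding down puts the grid indices less than \<open>x / 2 + 1\<close>
          apart, and \<open>x > 4\<close> makes this smaller than
          \<open>x - 1 < D\<^sub>2\<close>.\<close>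
        define x where "x = \<delta>\<^sub>2 / (2 * h)"
        have "t / h - s / h < x / 2"
          using divide_strict_right_mono[OF st(4) h0] by (simp add: diff_divide_distrib x_def)
        moreover have "4 < x" "x - 1 < real D\<^sub>2" using r D\<^sub>2 by (simp_all add: x_def)
        ultimately have "real j \<le> real i + real D\<^sub>2" using i j by linarith
        then have jD: "j \<le> i + D\<^sub>2" by linarith
        have ends: "dist (Y n \<omega> u) (Z l \<omega>) \<le> 2 * a"
          if "u \<in> {0..T}" "real l \<le> u / h" "u / h < real l + 1" "l \<le> N" for u l
        proof -
          have "h * real l \<le> u" "u < h * real l + h" using that h0 by (auto simp: field_simps)
          with that le_T[of l] h0 h(1) show ?thesis
            unfolding Z_def by (intro near) (auto simp: dist_real_def)
        qed
        have "dist (Y n \<omega> s) (Z i \<omega>) \<le> 2 * a" "dist (Y n \<omega> t) (Z j \<omega>) \<le> 2 * a"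
          using ends st i j ij jN by auto
        with grid[OF ij jN jD] show ?thesis
          using dist_triangle[of "Y n \<omega> s" "Y n \<omega> t" "Z i \<omega>"] dist_triangle[of "Z i \<omega>" "Y n \<omega> t" "Z j \<omega>"]
          by (simp add: a_def dist_commute)
      qed
      obtain s t where st: "s \<in> {0..T}" "t \<in> {0..T}" "dist s t < \<delta>\<^sub>2 / 4" "e < dist (Y n \<omega> s) (Y n \<omega> t)"
        using \<omega> by (auto simp: oscillates_def)
      then show False
        using le[of s t] le[of t s] by (cases "s \<le> t") (auto simp: dist_real_def dist_commute)
    qed
    then have "prob {\<omega> \<in> space M. oscillates T (Y n \<omega>) (\<delta>\<^sub>2 / 4) e}
        \<le> prob (B \<union> {\<omega> \<in> space M. oscillates T (Y n \<omega>) \<delta>' (2 * a)})"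
      using B(1) sets_oscillates[OF Ym cont] by (intro finite_measure_mono) auto
    also have "\<dots> \<le> prob B + prob {\<omega> \<in> space M. oscillates T (Y n \<omega>) \<delta>' (2 * a)}"
      using B(1) sets_oscillates[OF Ym cont] by (intro measure_Un_le) auto
    finally show ?thesis using PB \<delta>'(2) by simp
  qed
  then show ?thesis using \<delta>\<^sub>2(1) by (intro exI[of _ "\<delta>\<^sub>2 / 4"]) auto
qed

end

section \<open>Compact sets in the Skorohod space\<close>

lemma oscillates_restrict [simp]: "oscillates T (restrict f {0..T}) \<delta> e = oscillates T f \<delta> e"
  by (simp add: oscillates_def)

text \<open>The differences \<open>x - y\<close> of norm at least \<open>e\<close> form a compact
  set avoiding 0. By density no nonzero vector is orthogonal to all of \<open>V\<close>, so the open
  sets \<open>U (v, m)\<close> with \<open>v \<in> V\<close> cover it; a finite subcover yields both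
  \<open>W\<close> and the threshold.\<close>

lemma compact_weakly_separated:
  fixes V :: "'a::real_inner set"
  assumes V: "closure V = UNIV" and C: "compact C" and e: "0 < e"
  shows "\<exists>W a. finite W \<and> W \<subseteq> V \<and> 0 < a \<and>
    (\<forall>x\<in>C. \<forall>y\<in>C. e < dist x y \<longrightarrow> (\<exists>v\<in>W. a < dist (x \<bullet> v) (y \<bullet> v)))"
proof -
  define S where "S = {x - y |x y. x \<in> C \<and> y \<in> C} \<inter> {z. e \<le> norm z}"
  define U where "U p = {z. inverse (real (Suc (snd p))) < \<bar>z \<bullet> fst p\<bar>}" for p :: "'a \<times> nat"
  have "compact S"
    unfolding S_def
    by (intro compact_Int_closed compact_differences C closed_Collect_le continuous_intros)
  moreover have "open (U p)" for p
    unfolding U_def by (intro open_Collect_less continuous_intros)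
  moreover have "S \<subseteq> (\<Union>p\<in>V \<times> UNIV. U p)"
  proof
    fix z assume "z \<in> S"
    then have z: "z \<noteq> 0" using e by (auto simp: S_def)
    have "\<exists>v\<in>V. z \<bullet> v \<noteq> 0"
    proof (rule ccontr)
      assume "\<not> ?thesis"
      then have "V \<subseteq> {v. z \<bullet> v = 0}" by auto
      moreover have "closed {v. z \<bullet> v = 0}" by (intro closed_Collect_eq continuous_intros)
      ultimately have "closure V \<subseteq> {v. z \<bullet> v = 0}" by (rule closure_minimal)
      moreover have "z \<in> closure V" using V by simp
      ultimately have "z \<bullet> z = 0" by blast
      with z show False by simp
    qed
    then obtain v where v: "v \<in> V" "0 < \<bar>z \<bullet> v\<bar>" by auto
    obtain m where "inverse (real (Suc m)) < \<bar>z \<bullet> v\<bar>" using reals_Archimedean[OF v(2)] by blast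
    with v show "z \<in> (\<Union>p\<in>V \<times> UNIV. U p)"
      by (intro UN_I[of "(v, m)"]) (auto simp: U_def)
  qed
  ultimately obtain P where P: "P \<subseteq> V \<times> UNIV" "finite P" "S \<subseteq> (\<Union>p\<in>P. U p)"
    by (rule compactE_image)
  \<comment> \<open>The inserted 1 keeps the minimum meaningful when \<open>P\<close> is
    empty.\<close>
  define a where "a = Min (insert 1 ((\<lambda>p. inverse (real (Suc (snd p)))) ` P))"
  have "0 < a" unfolding a_def using P(2) by (subst Min_gr_iff) auto
  moreover have "\<exists>v\<in>fst ` P. a < dist (x \<bullet> v) (y \<bullet> v)" if xy: "x \<in> C" "y \<in> C" "e < dist x y" for x y
  proof -
    have "x - y \<in> S" using xy by (auto simp: S_def dist_norm)
    then obtain p where p: "p \<in> P" "x - y \<in> U p" using P(3) by blast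
    have "a \<le> inverse (real (Suc (snd p)))" unfolding a_def using P(2) p(1) by (intro Min_le) auto
    with p show ?thesis
      by (intro bexI[of _ "fst p"]) (auto simp: U_def dist_real_def inner_diff_left)
  qed
  ultimately show ?thesis
    using P by (intro exI[of _ "fst ` P"] exI[of _ a]) auto
qed

lemma continuous_imp_cadlag:
  assumes f: "continuous_on {0..T} f" "f \<in> extensional {0..T}"
  shows "f \<in> cadlag_paths T"
  unfolding cadlag_paths_def
proof (intro CollectI conjI ballI)
  have lim: "(f \<longlongrightarrow> f t) (at t within S)" if "t \<in> {0..T}" "S \<subseteq> {0..T}" for t S
    using f(1) that tendsto_within_subset unfolding continuous_on_def by blast
  show "(f \<longlongrightarrow> f t) (at_right t)" if "t \<in> {0..<T}" for t
    using lim[of t "{t..T}"] that at_within_Icc_at_right[of t T] by auto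
  show "\<exists>l. (f \<longlongrightarrow> l) (at_left t)" if "t \<in> {0<..T}" for t
    using lim[of t "{0..t}"] that at_within_Icc_at_left[of 0 t] by auto
qed (rule f(2))

text \<open>The identity is an admissible time change.\<close>

lemma skorohod_dist_less_uniform:
  assumes T: "0 \<le> T" and \<phi>: "\<phi> \<in> cadlag_paths T" and \<psi>: "\<psi> \<in> cadlag_paths T"
    and le: "\<And>t. t \<in> {0..T} \<Longrightarrow> dist (\<phi> t) (\<psi> t) \<le> c" and "c < r"
  shows "skorohod_dist T \<phi> \<psi> < r"
  unfolding skorohod_dist_less_iff[OF T \<phi> \<psi>]
proof (intro exI conjI bexI ballI)
  have "0 \<le> c" using le[of 0] T by (meson atLeastAtMost_iff order_refl order_trans zero_le_dist)
  then show "\<bar>t - t\<bar> \<le> c" for t :: real by simp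
qed (use assms id_in_time_changes in auto)

lemma mtopology_of_skorohod_metric:
  "0 \<le> T \<Longrightarrow> mtopology_of (skorohod_metric T) = Metric_space.mtopology (cadlag_paths T) (skorohod_dist T)"
  by (simp add: mtopology_of_def mspace_skorohod_metric mdist_skorohod_metric)

lemma continuous_on_if_not_oscillates:
  assumes "\<And>e. 0 < e \<Longrightarrow> \<exists>\<delta>>0. \<not> oscillates T f \<delta> e"
  shows "continuous_on {0..T} f"
  unfolding continuous_on_iff
proof (intro ballI allI impI)
  fix t and e :: real assume t: "t \<in> {0..T}" and e: "0 < e"
  obtain \<delta> where \<delta>: "0 < \<delta>" "\<not> oscillates T f \<delta> (e / 2)" using assms[of "e / 2"] e by auto
  have "dist (f s) (f t) < e" if "s \<in> {0..T}" "dist s t < \<delta>" for s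
  proof -
    have "dist (f s) (f t) \<le> e / 2" using \<delta>(2) that t unfolding oscillates_def by (meson not_less)
    with e show ?thesis by simp
  qed
  with \<delta>(1) show "\<exists>d>0. \<forall>s\<in>{0..T}. dist s t < d \<longrightarrow> dist (f s) (f t) < e" by blast
qed

text \<open>Arzela--Ascoli: an equicontinuous set is closed in a product of compact sets, and on it the
  product topology is finer than the topology of uniform convergence, hence than Skorohod's.\<close>

lemma compactin_skorohod_equicontinuous:
  fixes C :: "'b::metric_space set"
  assumes T: "0 \<le> T" and C: "compact C" and \<delta>: "\<And>k. 0 < \<delta> k"
  shows "compactin (mtopology_of (skorohod_metric T))
    {f \<in> {0..T} \<rightarrow>\<^sub>E C. \<forall>k::nat. \<not> oscillates T f (\<delta> k) (inverse (real (Suc k)))}"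
    (is "compactin _ ?K")
proof -
  define X where "X = product_topology (\<lambda>_. euclidean :: 'b topology) {0..T}"
  have proj: "continuous_map X euclidean (\<lambda>f. f t)" if "t \<in> {0..T}" for t
    unfolding X_def using continuous_map_product_projection[OF that, of "\<lambda>_. euclidean"] .
  have topX: "topspace X = {0..T} \<rightarrow>\<^sub>E UNIV" by (simp add: X_def)
  \<comment> \<open>Equicontinuity becomes an intersection of conditions on pairs of times, each
    closed under pointwise convergence; with Tychonoff's theorem this gives compactness in
    \<open>X\<close>.\<close>
  define I where "I = {(k, s, t). s \<in> {0..T} \<and> t \<in> {0..T} \<and> dist s t < \<delta> k}"
  define L where "L = (\<lambda>(k, s, t). {f \<in> topspace X. dist (f s) (f t) \<in> {..inverse (real (Suc k))}})"
  have "closedin X (L i)" if "i \<in> I" for i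
  proof -
    obtain k s t where i: "i = (k, s, t)" by (cases i)
    have "continuous_map X euclideanreal (\<lambda>f. dist (f s) (f t))"
      using continuous_map_mdist[of X euclidean_metric "\<lambda>f. f s" "\<lambda>f. f t"] proj[of s] proj[of t] that i
      by (simp add: I_def)
    then have "closedin X {f \<in> topspace X. dist (f s) (f t) \<in> {..inverse (real (Suc k))}}"
      by (rule closedin_continuous_map_preimage) simp
    then show ?thesis by (simp add: L_def i)
  qed
  then have "closedin X (\<Inter>(insert (topspace X) (L ` I)))"
    by (intro closedin_Inter) auto
  moreover have "compactin X ({0..T} \<rightarrow>\<^sub>E C)"
    unfolding X_def by (simp add: compactin_PiE C)
  ultimately have "compactin X (({0..T} \<rightarrow>\<^sub>E C) \<inter> \<Inter>(insert (topspace X) (L ` I)))"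
    by (intro compact_Int_closedin)
  also have "({0..T} \<rightarrow>\<^sub>E C) \<inter> \<Inter>(insert (topspace X) (L ` I)) = ?K"
  proof (intro set_eqI)
    fix f
    have "f \<in> \<Inter>(insert (topspace X) (L ` I)) \<longleftrightarrow> (\<forall>k. \<not> oscillates T f (\<delta> k) (inverse (real (Suc k))))"
      if "f \<in> {0..T} \<rightarrow>\<^sub>E C"
    proof -
      have "f \<in> topspace X" using that by (auto simp: topX)
      then have "f \<in> \<Inter>(insert (topspace X) (L ` I)) \<longleftrightarrow> (\<forall>k. \<forall>s\<in>{0..T}. \<forall>t\<in>{0..T}.
          dist s t < \<delta> k \<longrightarrow> dist (f s) (f t) \<le> inverse (real (Suc k)))"
        by (simp add: L_def I_def split_paired_Ball_Sigma del: atLeastAtMost_iff of_nat_Suc) blast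
      then show ?thesis unfolding oscillates_def by (meson not_less)
    qed
    then show "f \<in> ({0..T} \<rightarrow>\<^sub>E C) \<inter> \<Inter>(insert (topspace X) (L ` I)) \<longleftrightarrow> f \<in> ?K" by blast
  qed
  finally have K: "compactin X ?K" .
  interpret Sk: Metric_space "cadlag_paths T :: (real \<Rightarrow> 'b) set" "skorohod_dist T"
    by (rule Metric_space_skorohod[OF T])
  have cadlag: "f \<in> cadlag_paths T" if f: "f \<in> ?K" for f
  proof (rule continuous_imp_cadlag[OF continuous_on_if_not_oscillates])
    fix e :: real assume "0 < e"
    then obtain k where "inverse (real (Suc k)) < e" using reals_Archimedean by blast
    moreover have "\<not> oscillates T f (\<delta> k) (inverse (real (Suc k)))" using f by blast
    ultimately have "\<not> oscillates T f (\<delta> k) e"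
      unfolding oscillates_def by (meson less_trans)
    with \<delta> show "\<exists>\<delta>>0. \<not> oscillates T f \<delta> e" by blast
  qed (use f in \<open>simp add: PiE_def\<close>)
  have topK: "topspace (subtopology X ?K) = ?K"
    using compactin_subset_topspace[OF K] by (simp add: Int_absorb1)
  \<comment> \<open>Compactness is carried over as an image under the identity. Closeness at the
    finitely many points of \<open>S\<close> spreads by equicontinuity: three distances of at most
    \<open>e / 4\<close> each leave a strict margin below \<open>e\<close>.\<close>
  have "continuous_map (subtopology X ?K) Sk.mtopology (\<lambda>f. f)"
    unfolding Sk.continuous_map_to_metric topK
  proof (intro ballI allI impI)
    fix f and e :: real assume f: "f \<in> ?K" and e: "0 < e"
    obtain k where k: "inverse (real (Suc k)) < e / 4" using reals_Archimedean[of "e / 4"] e by auto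
    obtain S where S: "S \<subseteq> {0..T}" "finite S" "{0..T} \<subseteq> (\<Union>s\<in>S. ball s (\<delta> k))"
      by (rule compactE_image[of "{0..T}" "{0..T}" "\<lambda>s. ball s (\<delta> k)"]) (use \<delta> in auto)
    define U where "U = (\<Inter>s\<in>S. {g \<in> topspace X. g s \<in> ball (f s) (e / 4)}) \<inter> topspace X"
    have "openin X U"
      unfolding U_def using S by (intro openin_INT openin_continuous_map_preimage[OF proj]) auto
    then have "openin (subtopology X ?K) (?K \<inter> U)" by (rule openin_subtopology_Int2)
    moreover have "f \<in> ?K \<inter> U"
      using f e compactin_subset_topspace[OF K] by (auto simp: U_def)
    moreover have "g \<in> Sk.mball f e" if g: "g \<in> ?K \<inter> U" for g
    proof -
      have "dist (f t) (g t) \<le> 3 * (e / 4)" if t: "t \<in> {0..T}" for t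
      proof -
        obtain s where s: "s \<in> S" "dist s t < \<delta> k" using S t by auto
        have osc: "dist (h s) (h t) \<le> inverse (real (Suc k))" if "h \<in> ?K" for h
        proof -
          have "s \<in> {0..T}" using S(1) s(1) by blast
          moreover have "\<not> oscillates T h (\<delta> k) (inverse (real (Suc k)))" using that by blast
          ultimately show ?thesis using s(2) t unfolding oscillates_def by (meson not_less)
        qed
        have "dist (f s) (g s) < e / 4" using g s by (auto simp: U_def)
        with osc[OF f] osc[of g] g k show ?thesis
          using dist_triangle[of "f t" "g t" "f s"] dist_triangle[of "f s" "g t" "g s"]
          by (auto simp: dist_commute)
      qed
      then have "skorohod_dist T f g < e"
        using cadlag f g e by (intro skorohod_dist_less_uniform[OF T, where c = "3 * (e / 4)"]) auto
      then show ?thesis using cadlag f g by (auto simp: Sk.in_mball)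
    qed
    ultimately show "\<exists>U. openin (subtopology X ?K) U \<and> f \<in> U \<and> (\<forall>g\<in>U. g \<in> Sk.mball f e)" by blast
  qed
  moreover have "compactin (subtopology X ?K) ?K" using K by (simp add: compactin_subtopology)
  ultimately have "compactin Sk.mtopology ((\<lambda>f. f) ` ?K)" by (intro image_compactin)
  then show ?thesis by (simp add: mtopology_of_skorohod_metric[OF T])
qed

section \<open>Continuous paths inside the Skorohod space\<close>

lemma mspace_C_metric_iff:
  "f \<in> mspace (C_metric T) \<longleftrightarrow> f \<in> extensional {0..T} \<and> continuous_on {0..T} f"
proof -
  have "bounded (f ` {0..T})" if "continuous_on {0..T} f"
    using compact_continuous_image[OF that] by (simp add: compact_imp_bounded)
  then show ?thesis by auto
qed

text \<open>A bound for \<open>\<iota>\<close> is a Lipschitz constant from the supremum metric to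
  the Skorohod metric. Continuity then makes the embedded process a random element of the Skorohod
  space.\<close>

lemma continuous_map_C_to_skorohod:
  fixes \<iota> :: "'a::real_normed_vector \<Rightarrow> 'b::real_normed_vector"
  assumes T: "0 \<le> T" and \<iota>: "bounded_linear \<iota>"
  shows "continuous_map (mtopology_of (C_metric T)) (mtopology_of (skorohod_metric T))
    (\<lambda>f. restrict (\<lambda>t. \<iota> (f t)) {0..T})"
proof (rule Lipschitz_continuous_imp_continuous_map, unfold Lipschitz_continuous_map_def, intro conjI)
  let ?J = "\<lambda>f. restrict (\<lambda>t. \<iota> (f t)) {0..T}"
  have mem: "?J f \<in> cadlag_paths T" if "f \<in> mspace (C_metric T)" for f
  proof (rule continuous_imp_cadlag)
    have "continuous_on {0..T} (\<lambda>t. \<iota> (f t))"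
      using that unfolding mspace_C_metric_iff
      by (intro bounded_linear.continuous_on[OF \<iota>]) simp
    then show "continuous_on {0..T} (?J f)" by (rule continuous_on_eq) simp
  qed simp
  then show "?J \<in> mspace (C_metric T) \<rightarrow> mspace (skorohod_metric T)"
    by (simp add: mspace_skorohod_metric[OF T] Pi_iff)
  obtain B where B: "\<And>x. norm (\<iota> x) \<le> norm x * B" "0 < B" using bounded_linear.pos_bounded[OF \<iota>] by blast
  have "skorohod_dist T (?J f) (?J g) \<le> B * mdist (C_metric T) f g"
    if f: "f \<in> mspace (C_metric T)" and g: "g \<in> mspace (C_metric T)" for f g
  proof (rule dense_ge)
    fix r assume r: "B * mdist (C_metric T) f g < r"
    show "skorohod_dist T (?J f) (?J g) \<le> r"
    proof (rule less_imp_le, rule skorohod_dist_less_uniform[OF T mem[OF f] mem[OF g] _ r])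
      fix t assume t: "t \<in> {0..T}"
      have "dist (\<iota> (f t)) (\<iota> (g t)) \<le> B * dist (f t) (g t)"
        using B(1)[of "f t - g t"] by (simp add: dist_norm bounded_linear.linear[OF \<iota>] linear_diff mult.commute)
      also have "dist (f t) (g t) \<le> mdist (C_metric T) f g"
        using cfunspace_mdist_le[OF f g, of "mdist (C_metric T) f g"] t by auto
      finally show "dist (?J f t) (?J g t) \<le> B * mdist (C_metric T) f g"
        using B(2) t by simp
    qed
  qed
  then show "\<exists>B. \<forall>f\<in>mspace (C_metric T). \<forall>g\<in>mspace (C_metric T).
      mdist (skorohod_metric T) (?J f) (?J g) \<le> B * mdist (C_metric T) f g"
    unfolding mdist_skorohod_metric[OF T] by blast
qed

section \<open>Borel \<sigma>-algebras of abstract topologies\<close>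

lemma space_borel_of [simp]: "space (borel_of X) = topspace X"
  unfolding borel_of_def by (rule space_measure_of) (blast dest: openin_subset)

lemma openin_imp_borel_of: "openin X U \<Longrightarrow> U \<in> sets (borel_of X)"
  unfolding borel_of_def by (subst sets_measure_of) (blast dest: openin_subset)+

lemma closedin_imp_borel_of:
  assumes "closedin X C"
  shows "C \<in> sets (borel_of X)"
proof -
  have "space (borel_of X) - (topspace X - C) \<in> sets (borel_of X)"
    using assms by (intro sets.compl_sets openin_imp_borel_of) auto
  moreover have "topspace X - (topspace X - C) = C" using closedin_subset[OF assms] by blast
  ultimately show ?thesis by simp
qed

lemma continuous_map_imp_measurable_borel_of:
  assumes "continuous_map X Y f"
  shows "f \<in> borel_of X \<rightarrow>\<^sub>M borel_of Y"
  unfolding borel_of_def[of Y]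
proof (rule measurable_measure_of)
  fix U assume "U \<in> {U. openin Y U}"
  then have "openin X {x \<in> topspace X. f x \<in> U}"
    using openin_continuous_map_preimage[OF assms] by simp
  then have "{x \<in> topspace X. f x \<in> U} \<in> sets (borel_of X)" by (rule openin_imp_borel_of)
  also have "{x \<in> topspace X. f x \<in> U} = f -` U \<inter> space (borel_of X)" by auto
  finally show "f -` U \<inter> space (borel_of X) \<in> sets (borel_of X)" .
qed (use assms in \<open>auto simp: continuous_map_def dest!: openin_subset\<close>)

section \<open>Tightness\<close>

text \<open>A bound \<open>\<le> R\<close> on a countable dense set of times extends to its closure
  by continuity, so the event is a countable union.\<close>

lemma sets_exists_norm_greater:
  fixes X :: "'w \<Rightarrow> real \<Rightarrow> 'b::{real_normed_vector, second_countable_topology}"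
  assumes X: "\<And>t. t \<in> {0..T} \<Longrightarrow> (\<lambda>\<omega>. X \<omega> t) \<in> borel_measurable M"
    and cont: "\<And>\<omega>. \<omega> \<in> space M \<Longrightarrow> continuous_on {0..T} (X \<omega>)"
  shows "{\<omega> \<in> space M. \<exists>t\<in>{0..T}. R < norm (X \<omega> t)} \<in> sets M"
proof -
  obtain Q where Q: "countable Q" "Q \<subseteq> {0..T}" "{0..T} \<subseteq> closure Q"
    using separable[of "{0..T}"] by blast
  have cl: "closure Q = {0..T}"
    using closure_minimal[OF Q(2)] Q(3) by auto
  have "(\<exists>t\<in>{0..T}. R < norm (X \<omega> t)) \<longleftrightarrow> (\<exists>t\<in>Q. R < norm (X \<omega> t))" if "\<omega> \<in> space M" for \<omega>
  proof
    assume ex: "\<exists>t\<in>{0..T}. R < norm (X \<omega> t)"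
    show "\<exists>t\<in>Q. R < norm (X \<omega> t)"
    proof (rule ccontr)
      assume "\<not> ?thesis"
      then have le: "norm (X \<omega> t) \<le> R" if "t \<in> Q" for t using that by (meson not_less)
      have "continuous_on (closure Q) (\<lambda>t. norm (X \<omega> t))"
        unfolding cl using cont[OF that] by (rule continuous_on_norm)
      from continuous_le_on_closure[OF this _ le] ex show False unfolding cl by (meson not_less)
    qed
  qed (use Q(2) in blast)
  then have eq: "{\<omega> \<in> space M. \<exists>t\<in>{0..T}. R < norm (X \<omega> t)} = (\<Union>t\<in>Q. {\<omega> \<in> space M. R < norm (X \<omega> t)})"
    by blast
  have "{\<omega> \<in> space M. R < norm (X \<omega> t)} \<in> sets M" if "t \<in> Q" for t
    using X Q that by (intro borel_measurable_less borel_measurable_norm) auto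
  then show ?thesis
    unfolding eq using Q(1) by (intro sets.countable_UN') auto
qed

text \<open>Markov's inequality: \<open>R\<close> times the indicator of the event lies below the
  pathwise supremum.\<close>

lemma (in prob_space) prob_exists_norm_greater_le:
  fixes X :: "'a \<Rightarrow> real \<Rightarrow> 'b::{real_normed_vector, second_countable_topology}"
  assumes X: "\<And>t. t \<in> {0..T} \<Longrightarrow> (\<lambda>\<omega>. X \<omega> t) \<in> borel_measurable M"
    and cont: "\<And>\<omega>. \<omega> \<in> space M \<Longrightarrow> continuous_on {0..T} (X \<omega>)"
    and R: "0 < R" and c: "0 \<le> c"
    and le: "(\<integral>\<^sup>+ \<omega>. (SUP t\<in>{0..T}. ennreal (norm (X \<omega> t))) \<partial>M) \<le> ennreal c"
  shows "prob {\<omega> \<in> space M. \<exists>t\<in>{0..T}. R < norm (X \<omega> t)} \<le> c / R"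
    (is "prob ?A \<le> _")
proof -
  have A: "?A \<in> events" by (rule sets_exists_norm_greater[OF X cont])
  have "ennreal R * indicator ?A \<omega> \<le> (SUP t\<in>{0..T}. ennreal (norm (X \<omega> t)))" for \<omega>
  proof (cases "\<omega> \<in> ?A")
    case True
    then obtain t where "t \<in> {0..T}" "R < norm (X \<omega> t)" by blast
    then show ?thesis using True by (intro SUP_upper2[of t]) (auto intro: ennreal_leI)
  qed simp
  then have "(\<integral>\<^sup>+ \<omega>. ennreal R * indicator ?A \<omega> \<partial>M) \<le> ennreal c"
    by (intro order_trans[OF nn_integral_mono le])
  then have "ennreal (R * prob ?A) \<le> ennreal c"
    using A R by (simp add: nn_integral_cmult_indicator emeasure_eq_measure ennreal_mult)
  then show ?thesis
    using R c by (simp add: field_simps)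
qed

text \<open>Adaptedness makes the exit times of the processes stopping times, so that
  \<open>increments\<close> can be tested on them. The moments are nonnegative integrals, so their
  finiteness is a statement in the extended reals.\<close>

theorem lemma3p3p3:
  fixes M :: "'w measure" and F :: "real \<Rightarrow> 'w measure"
    and \<iota> :: "'h1::{real_inner, polish_space} \<Rightarrow> 'h2::{real_inner, polish_space}"
    and V :: "'h2 set" and T :: real
    and \<Psi> :: "nat \<Rightarrow> 'w \<Rightarrow> real \<Rightarrow> 'h1"
  assumes "filtered_prob_space M F"
    and "compact_embedding \<iota>"
    and "closure V = UNIV"
    and "0 < T"
    and measurable: "\<And>n. \<Psi> n \<in> measurable M (borel_of (mtopology_of (C_metric T)))"
    and adapted: "\<And>n t. t \<in> {0..T} \<Longrightarrow> (\<lambda>\<omega>. \<Psi> n \<omega> t) \<in> borel_measurable (F t)"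
    and moments: "(SUP n. \<integral>\<^sup>+ \<omega>. (SUP t\<in>{0..T}. ennreal (norm (\<Psi> n \<omega> t))) \<partial>M) < \<infinity>"
    and increments: "\<And>\<gamma> \<epsilon> v.
      (\<And>n. nonneg_stopping_time F (\<gamma> n)) \<Longrightarrow>
      (\<And>n \<omega>. \<omega> \<in> space M \<Longrightarrow> \<gamma> n \<omega> \<in> {0..T}) \<Longrightarrow>
      0 < \<epsilon> \<Longrightarrow> v \<in> V \<Longrightarrow>
      ((\<lambda>\<delta>. SUP n. \<P>(\<omega> in M.
          \<bar>(\<iota> (\<Psi> n \<omega> (min (\<gamma> n \<omega> + \<delta>) T)) - \<iota> (\<Psi> n \<omega> (\<gamma> n \<omega>))) \<bullet> v\<bar> > \<epsilon>)) \<longlongrightarrow> 0) (at_right 0)"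
  shows "tight_in (mtopology_of (skorohod_metric T))
    (\<lambda>n. distr M (borel_of (mtopology_of (skorohod_metric T)))
           (\<lambda>\<omega>. restrict (\<lambda>t. \<iota> (\<Psi> n \<omega> t)) {0..T}))"
proof -
  interpret filtered_prob_space M F by fact
  have T: "0 < T" "0 \<le> T" using \<open>0 < T\<close> by auto
  have \<iota>: "bounded_linear \<iota>" and compact: "bounded B \<Longrightarrow> compact (closure (\<iota> ` B))" for B
    using \<open>compact_embedding \<iota>\<close> by (auto simp: compact_embedding_def)
  define D where "D = mtopology_of (skorohod_metric T :: (real \<Rightarrow> 'h2) metric)"
  define J where "J n \<omega> = restrict (\<lambda>t. \<iota> (\<Psi> n \<omega> t)) {0..T}" for n \<omega>
  have J[measurable]: "J n \<in> M \<rightarrow>\<^sub>M borel_of D" for n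
    using measurable_compose[OF measurable
        continuous_map_imp_measurable_borel_of[OF continuous_map_C_to_skorohod[OF T(2) \<iota>]]]
    by (simp add: J_def[abs_def] D_def)
  have cont: "continuous_on {0..T} (\<Psi> n \<omega>)" if "\<omega> \<in> space M" for n \<omega>
    using measurable_space[OF measurable that, of n] by (simp add: mspace_C_metric_iff del: mspace_cfunspace)
  have cont_\<iota>: "continuous_on {0..T} (\<lambda>t. \<iota> (\<Psi> n \<omega> t))" if "\<omega> \<in> space M" for n \<omega>
    using cont[OF that] by (rule bounded_linear.continuous_on[OF \<iota>])
  have \<Psi>m: "(\<lambda>\<omega>. \<Psi> n \<omega> t) \<in> borel_measurable M" if "t \<in> {0..T}" for n t
    using measurable_from_F[OF adapted] that by simp
  have \<iota>_borel: "\<iota> \<in> borel_measurable borel"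
    using linear_continuous_on[OF \<iota>] by (rule borel_measurable_continuous_onI)
  have adapted_\<iota>: "(\<lambda>\<omega>. \<iota> (\<Psi> n \<omega> t)) \<in> borel_measurable (F t)" if "t \<in> {0..T}" for n t
    using measurable_compose[OF adapted[OF that] \<iota>_borel] .
  have \<iota>m: "(\<lambda>\<omega>. \<iota> (\<Psi> n \<omega> t)) \<in> borel_measurable M" if "t \<in> {0..T}" for n t
    using measurable_from_F[OF adapted_\<iota>] that by simp

  \<comment> \<open>Two upgrades for each scalar process: from sequences of stopping times to a
    bound uniform over all stopping times, and from there to the modulus of continuity.\<close>
  have weak: "\<exists>\<delta>>0. \<forall>n. prob {\<omega> \<in> space M. oscillates T (\<lambda>t. \<iota> (\<Psi> n \<omega> t) \<bullet> v) \<delta> e} \<le> p"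
    if v: "v \<in> V" and e: "0 < e" and p: "0 < p" for v e p
  proof (rule uniform_modulus_of_continuity[OF T(1) _ _ _ e p])
    show adapted_v: "(\<lambda>\<omega>. \<iota> (\<Psi> n \<omega> t) \<bullet> v) \<in> borel_measurable (F t)" if "t \<in> {0..T}" for n t
      using adapted_\<iota>[OF that] by (intro borel_measurable_inner) auto
    show cont_v: "continuous_on {0..T} (\<lambda>t. \<iota> (\<Psi> n \<omega> t) \<bullet> v)" if "\<omega> \<in> space M" for n \<omega>
      using cont_\<iota>[OF that] by (intro continuous_intros)
    fix a \<eta> :: real assume a: "0 < a" and \<eta>: "0 < \<eta>"
    show "\<exists>\<delta>\<^sub>0>0. \<forall>n \<gamma> \<delta>. nonneg_stopping_time F \<gamma> \<longrightarrow> (\<forall>\<omega>\<in>space M. \<gamma> \<omega> \<in> {0..T}) \<longrightarrow> 0 < \<delta> \<longrightarrow> \<delta> \<le> \<delta>\<^sub>0 \<longrightarrow>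
        \<P>(\<omega> in M. a < dist (\<iota> (\<Psi> n \<omega> (min (\<gamma> \<omega> + \<delta>) T)) \<bullet> v) (\<iota> (\<Psi> n \<omega> (\<gamma> \<omega>)) \<bullet> v)) \<le> \<eta>"
    proof (rule uniform_over_stopping_times[OF T(1) adapted_v cont_v _ a \<eta>])
      fix \<gamma> :: "nat \<Rightarrow> 'w \<Rightarrow> real"
      assume "\<And>n. nonneg_stopping_time F (\<gamma> n)" "\<And>n \<omega>. \<omega> \<in> space M \<Longrightarrow> \<gamma> n \<omega> \<in> {0..T}"
      from increments[OF this a v]
      show "((\<lambda>\<delta>. SUP n. \<P>(\<omega> in M. a < dist (\<iota> (\<Psi> n \<omega> (min (\<gamma> n \<omega> + \<delta>) T)) \<bullet> v)
          (\<iota> (\<Psi> n \<omega> (\<gamma> n \<omega>)) \<bullet> v))) \<longlongrightarrow> 0) (at_right 0)"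
        by (simp add: dist_real_def inner_diff_left)
    qed
  qed

  \<comment> \<open>While a path stays in the ball of radius \<open>R\<close>, its image stays in a
    compact set, where a large increment is seen by one of finitely many functionals from
    \<open>V\<close>.\<close>
  have strong: "\<exists>\<delta>>0. \<forall>n. prob {\<omega> \<in> space M.
      \<not> (\<exists>t\<in>{0..T}. R < norm (\<Psi> n \<omega> t)) \<and> oscillates T (\<lambda>t. \<iota> (\<Psi> n \<omega> t)) \<delta> e} \<le> p"
    if e: "0 < e" and p: "0 < p" for R e p
  proof -
    obtain W a where W: "finite W" "W \<subseteq> V" and a: "0 < a"
      and sep: "\<forall>x\<in>closure (\<iota> ` cball 0 R). \<forall>y\<in>closure (\<iota> ` cball 0 R). e < dist x y \<longrightarrow>
        (\<exists>v\<in>W. a < dist (x \<bullet> v) (y \<bullet> v))"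
      using compact_weakly_separated[OF \<open>closure V = UNIV\<close> compact[OF bounded_cball[of 0 R]] e] by blast
    \<comment> \<open>The union bound over \<open>W\<close> then costs at most \<open>p\<close>; the
      added 1 keeps the denominator positive for empty \<open>W\<close>.\<close>
    define p' where "p' = p / (real (card W) + 1)"
    have p': "0 < p'" using p by (simp add: p'_def)
    have "\<forall>v\<in>W. \<exists>\<delta>>0. \<forall>n. prob {\<omega> \<in> space M. oscillates T (\<lambda>t. \<iota> (\<Psi> n \<omega> t) \<bullet> v) \<delta> a} \<le> p'"
      using W(2) by (intro ballI weak a p') blast
    from bchoice[OF this] obtain d where d: "\<forall>v\<in>W. 0 < d v \<and>
      (\<forall>n. prob {\<omega> \<in> space M. oscillates T (\<lambda>t. \<iota> (\<Psi> n \<omega> t) \<bullet> v) (d v) a} \<le> p')" ..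
    define \<delta> where "\<delta> = Min (insert 1 (d ` W))"
    have \<delta>: "0 < \<delta>" unfolding \<delta>_def using W(1) d by (subst Min_gr_iff) auto
    have le: "\<delta> \<le> d v" if "v \<in> W" for v unfolding \<delta>_def using W(1) that by (intro Min_le) auto
    have "prob {\<omega> \<in> space M. \<not> (\<exists>t\<in>{0..T}. R < norm (\<Psi> n \<omega> t)) \<and>
        oscillates T (\<lambda>t. \<iota> (\<Psi> n \<omega> t)) \<delta> e} \<le> p" (is "prob ?E \<le> p") for n
    proof -
      define B where "B v = {\<omega> \<in> space M. oscillates T (\<lambda>t. \<iota> (\<Psi> n \<omega> t) \<bullet> v) (d v) a}" for v
      have B: "B v \<in> events" for v
        unfolding B_def
        by (rule sets_oscillates[OF borel_measurable_inner[OF \<iota>m borel_measurable_const]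
              continuous_on_inner[OF cont_\<iota> continuous_on_const]])
      have "?E \<subseteq> (\<Union>v\<in>W. B v)"
      proof
        fix \<omega> assume \<omega>: "\<omega> \<in> ?E"
        then have "oscillates T (\<lambda>t. \<iota> (\<Psi> n \<omega> t)) \<delta> e" by simp
        then obtain s t where st: "s \<in> {0..T}" "t \<in> {0..T}" "dist s t < \<delta>"
          "e < dist (\<iota> (\<Psi> n \<omega> s)) (\<iota> (\<Psi> n \<omega> t))"
          unfolding oscillates_def by blast
        have "\<iota> (\<Psi> n \<omega> u) \<in> closure (\<iota> ` cball 0 R)" if "u \<in> {0..T}" for u
        proof -
          have "norm (\<Psi> n \<omega> u) \<le> R" using \<omega> that by (simp add: not_less)
          then show ?thesis by (intro subsetD[OF closure_subset] imageI) simp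
        qed
        from sep[rule_format, OF this[OF st(1)] this[OF st(2)] st(4)]
        obtain v where v: "v \<in> W" "a < dist (\<iota> (\<Psi> n \<omega> s) \<bullet> v) (\<iota> (\<Psi> n \<omega> t) \<bullet> v)" ..
        have "dist s t < d v" using st(3) le[OF v(1)] by linarith
        with st v have "oscillates T (\<lambda>t. \<iota> (\<Psi> n \<omega> t) \<bullet> v) (d v) a"
          unfolding oscillates_def by blast
        with \<omega> v(1) show "\<omega> \<in> (\<Union>v\<in>W. B v)" unfolding B_def by blast
      qed
      then have "prob ?E \<le> prob (\<Union>v\<in>W. B v)"
        using B W(1) by (intro finite_measure_mono) auto
      also have "\<dots> \<le> (\<Sum>v\<in>W. prob (B v))"
        using B W(1) by (intro finite_measure_subadditive_finite) auto
      also have "\<dots> \<le> (\<Sum>v\<in>W. p')"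
        using d by (intro sum_mono) (auto simp: B_def)
      also have "\<dots> \<le> p" using p by (simp add: p'_def field_simps)
      finally show ?thesis .
    qed
    with \<delta> show ?thesis by blast
  qed

  have "tight_in D (\<lambda>n. distr M (borel_of D) (J n))"
    unfolding tight_in_def
  proof (intro conjI allI impI)
    show "prob_space (distr M (borel_of D) (J n))" for n by (rule prob_space_distr[OF J])
    show "sets (distr M (borel_of D) (J n)) = sets (borel_of D)" for n by simp
    fix \<epsilon> :: real assume \<epsilon>: "0 < \<epsilon>"
    obtain c where c: "0 \<le> c"
      "(SUP n. \<integral>\<^sup>+ \<omega>. (SUP t\<in>{0..T}. ennreal (norm (\<Psi> n \<omega> t))) \<partial>M) = ennreal c"
      using moments by (cases "SUP n. \<integral>\<^sup>+ \<omega>. (SUP t\<in>{0..T}. ennreal (norm (\<Psi> n \<omega> t))) \<partial>M") auto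
    \<comment> \<open>Makes the Markov bound \<open>c / R\<close> at most
      \<open>\<epsilon> / 2\<close>; the added 1 keeps \<open>R\<close> positive when
      \<open>c = 0\<close>.\<close>
    define R where "R = 2 * (c + 1) / \<epsilon>"
    have R: "0 < R" using c(1) \<epsilon> by (simp add: R_def)
    define A where "A n = {\<omega> \<in> space M. \<exists>t\<in>{0..T}. R < norm (\<Psi> n \<omega> t)}" for n
    have A: "A n \<in> events" for n
      unfolding A_def by (rule sets_exists_norm_greater[OF \<Psi>m cont])
    have PA: "prob (A n) \<le> \<epsilon> / 2" for n
    proof -
      have "prob (A n) \<le> c / R"
        unfolding A_def
        by (intro prob_exists_norm_greater_le[OF \<Psi>m cont R c(1)]) (unfold c(2)[symmetric], auto intro: SUP_upper)
      also have "c / R \<le> \<epsilon> / 2" using c(1) \<epsilon> by (simp add: R_def field_simps)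
      finally show ?thesis .
    qed
    \<comment> \<open>These tolerances sum to \<open>\<epsilon> / 2\<close> over all
      \<open>k\<close>, the half left by the moment bound.\<close>
    define p where "p k = \<epsilon> / 2 * (1 / 2) ^ Suc k" for k
    have "\<forall>k. \<exists>\<delta>>0. \<forall>n. prob {\<omega> \<in> space M. \<not> (\<exists>t\<in>{0..T}. R < norm (\<Psi> n \<omega> t)) \<and>
        oscillates T (\<lambda>t. \<iota> (\<Psi> n \<omega> t)) \<delta> (inverse (real (Suc k)))} \<le> p k"
      using \<epsilon> by (intro allI strong) (auto simp: p_def)
    from choice[OF this] obtain \<delta> where \<delta>': "\<forall>k. 0 < \<delta> k \<and>
      (\<forall>n. prob {\<omega> \<in> space M. \<not> (\<exists>t\<in>{0..T}. R < norm (\<Psi> n \<omega> t)) \<and>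
        oscillates T (\<lambda>t. \<iota> (\<Psi> n \<omega> t)) (\<delta> k) (inverse (real (Suc k)))} \<le> p k)" ..
    then have \<delta>: "0 < \<delta> k" for k by simp
    \<comment> \<open>One set serves all \<open>n\<close>, because \<open>R\<close> and every
      \<open>\<delta> k\<close> were chosen uniformly in \<open>n\<close>.\<close>
    define K where "K = {f \<in> {0..T} \<rightarrow>\<^sub>E closure (\<iota> ` cball 0 R).
      \<forall>k::nat. \<not> oscillates T f (\<delta> k) (inverse (real (Suc k)))}"
    have K: "compactin D K"
      unfolding D_def K_def by (rule compactin_skorohod_equicontinuous[OF T(2) compact[OF bounded_cball] \<delta>])
    \<comment> \<open>In a Hausdorff space compact sets are closed, so \<open>K\<close> is
      Borel.\<close>
    have "Hausdorff_space D"
      unfolding D_def mtopology_of_skorohod_metric[OF T(2)]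
      by (rule Metric_space.Hausdorff_space_mtopology[OF Metric_space_skorohod[OF T(2)]])
    then have KB: "K \<in> sets (borel_of D)"
      by (intro closedin_imp_borel_of compactin_imp_closedin K)
    have "1 - \<epsilon> \<le> measure (distr M (borel_of D) (J n)) K" for n
    proof -
      define E where "E k = {\<omega> \<in> space M. \<not> (\<exists>t\<in>{0..T}. R < norm (\<Psi> n \<omega> t)) \<and>
        oscillates T (\<lambda>t. \<iota> (\<Psi> n \<omega> t)) (\<delta> k) (inverse (real (Suc k)))}" for k
      have Em: "E k \<in> events" for k
        unfolding E_def using sets_oscillates[OF \<iota>m cont_\<iota>] A[of n]
        by (intro sets.sets_Collect_conj sets.sets_Collect_neg) (auto simp: A_def)
      have prob_E: "prob (E k) \<le> p k" for k using \<delta>' unfolding E_def by blast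
      have sums: "p sums (\<epsilon> / 2)"
        using sums_mult[OF power_half_series, of "\<epsilon> / 2"] by (simp add: p_def[abs_def])
      have summable: "summable (\<lambda>k. prob (E k))"
        using prob_E by (intro summable_comparison_test'[OF sums_summable[OF sums], of 0]) simp
      have "prob (\<Union>k. E k) \<le> (\<Sum>k. prob (E k))"
        using Em by (intro finite_measure_subadditive_countably summable) auto
      also have "\<dots> \<le> suminf p"
        by (intro suminf_le prob_E summable sums_summable[OF sums])
      also have "\<dots> = \<epsilon> / 2" using sums by (rule sums_unique[symmetric])
      finally have "prob (\<Union>k. E k) \<le> \<epsilon> / 2" .
      moreover have "prob (A n \<union> (\<Union>k. E k)) \<le> prob (A n) + prob (\<Union>k. E k)"
        using A Em by (intro measure_Un_le) auto
      ultimately have "prob (A n \<union> (\<Union>k. E k)) \<le> \<epsilon>" using PA[of n] by linarith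
      \<comment> \<open>A path that stays in the ball and obeys every modulus bound lies in
        \<open>K\<close>. The events \<open>E k\<close> record oscillation only inside the ball, so
        leaving the ball is excluded first, through \<open>A n\<close>.\<close>
      moreover have "space M - (J n -` K \<inter> space M) \<subseteq> A n \<union> (\<Union>k. E k)"
      proof
        fix \<omega> assume \<omega>: "\<omega> \<in> space M - (J n -` K \<inter> space M)"
        show "\<omega> \<in> A n \<union> (\<Union>k. E k)"
        proof (rule ccontr)
          assume no: "\<omega> \<notin> A n \<union> (\<Union>k. E k)"
          then have bound: "\<not> (\<exists>t\<in>{0..T}. R < norm (\<Psi> n \<omega> t))" using \<omega> by (simp add: A_def)
          then have "\<not> oscillates T (J n \<omega>) (\<delta> k) (inverse (real (Suc k)))" for k
            using no \<omega> unfolding J_def oscillates_restrict E_def by blast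
          moreover have "J n \<omega> \<in> {0..T} \<rightarrow>\<^sub>E closure (\<iota> ` cball 0 R)"
          proof (rule PiE_I)
            fix t assume t: "t \<in> {0..T}"
            then have "norm (\<Psi> n \<omega> t) \<le> R" using bound by (simp add: not_less)
            then have "\<iota> (\<Psi> n \<omega> t) \<in> closure (\<iota> ` cball 0 R)"
              by (intro subsetD[OF closure_subset] imageI) simp
            with t show "J n \<omega> t \<in> closure (\<iota> ` cball 0 R)" by (simp add: J_def)
          qed (simp only: J_def restrict_apply if_False)
          ultimately have "J n \<omega> \<in> K" by (simp add: K_def)
          with \<omega> show False by simp
        qed
      qed
      then have "prob (space M - (J n -` K \<inter> space M)) \<le> prob (A n \<union> (\<Union>k. E k))"
        using A Em by (intro finite_measure_mono) auto
      moreover have "prob (space M - (J n -` K \<inter> space M)) = 1 - prob (J n -` K \<inter> space M)"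
        by (rule prob_compl) (rule measurable_sets[OF J KB])
      ultimately show ?thesis
        by (simp add: measure_distr[OF J KB])
    qed
    with K KB show "\<exists>K. compactin D K \<and> K \<in> sets (borel_of D) \<and>
        (\<forall>n. 1 - \<epsilon> \<le> measure (distr M (borel_of D) (J n)) K)"
      by blast
  qed
  then show ?thesis by (simp add: D_def J_def[abs_def])
qed

end
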